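(* Let $\|\cdot\|$ be an admissible norm on $\mathbb{R}^3$, let $f:M\to(\mathbb{R}^3,\|\cdot\|)$ be a surface of constant Minkowski width having positive Minkowski Gaussian curvature, and let $p,q\in M$ be any distinct points with parallel tangent planes. Then $$\frac{1}{\max_{X\in S_p}k_{M,p}(X)}+\frac{1}{\min_{Y\in S_q}k_{M,q}(Y)}=c,$$ where $c\in\mathbb{R}$ is the (Minkowski) width of $M$.
   Context: A norm $\|\cdot\|$ on $\mathbb{R}^3$ is admissible if its unit sphere $\partial B=\{x\in\mathbb{R}^3:\|x\|=1\}$ is a smooth surface of strictly positive Gaussian curvature in the usual Euclidean geometry of $\mathbb{R}^3$. A non-zero vector $v$ is Birkhoff orthogonal to a plane $P$ (through the origin), written $v\dashv_B P$, if $\|v+tw\|\ge\|v\|$ for all $t\in\mathbb{R}$, $w\in P$. Surfaces are smooth and orientable, immersions are smooth, and $M$ is identified with its image, $T_pM$ being regarded as a plane in $\mathbb{R}^3$. The Birkhoff-Gauss map $\eta:M\to\partial B$ is the smooth map with $\eta(p)\dashv_B T_pM$ for all $p$, chosen here to point outward of the convex surface $M$. Since $T_{\eta(p)}\partial B$ is parallel to $T_pM$, $d\eta_p$ is an endomorphism of $T_pM$; the Minkowski Gaussian curvature is $K(p)=\det(d\eta_p)$. Let $\langle\cdot,\cdot\rangle$ be the usual inner product and $u^{-1}$ the (outward) Euclidean Gauss map of $\partial B$. The normal curvature of $M$ at $p$ in the direction of a non-zero $V\in T_pM$ is $$k_{M,p}(V)=\frac{\langle du^{-1}_{\eta(p)}V,d\eta_pV\rangle}{\langle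 du^{-1}_{\eta(p)}V,V\rangle}.$$ $S_p=\{x\in T_pM:\|x\|=1\}$ is the unit circle of $T_pM$. A compact, strictly convex immersed surface $M$ without boundary has constant Minkowski width if the distance (in the norm $\|\cdot\|$) between any two parallel supporting planes of $M$ is the same; this common value is the width of $M$. *)

theory Defs
  imports "HOL-Analysis.Analysis"
begin

section \<open>Smooth maps between open subsets of Euclidean spaces\<close>

primrec Ck_on :: "nat \<Rightarrow> 'a::euclidean_space set \<Rightarrow> ('a \<Rightarrow> 'b::euclidean_space) \<Rightarrow> bool" where
  "Ck_on 0 U g \<longleftrightarrow> continuous_on U g"
| "Ck_on (Suc k) U g \<longleftrightarrow> (\<forall>x\<in>U. g differentiable (at x)) \<and>
      (\<forall>v. Ck_on k U (\<lambda>x. frechet_derivative g (at x) v))"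

text \<open>Only meant for open sets, since the derivatives are taken at full neighbourhoods.\<close>

definition smooth_on :: "'a::euclidean_space set \<Rightarrow> ('a \<Rightarrow> 'b::euclidean_space) \<Rightarrow> bool" where
  "smooth_on U g \<longleftrightarrow> (\<forall>k. Ck_on k U g)"


section \<open>Immersed surfaces in three-space\<close>

text \<open>An immersed surface is a topological surface \<open>X\<close> with a map \<open>f\<close> into three-space. The
  smooth structure of \<open>X\<close> is not a separate datum: when \<open>f\<close> is an immersion, the smooth local
  parametrizations of \<open>X\<close> are exactly the topological ones for which \<open>f \<circ> \<phi>\<close> is a smooth
  immersion of a plane domain, and the transition maps between these are automatically
  smooth. A regular surface \<open>S\<close> embedded in three-space is the case of the subspace topology
  \<open>top_of_set S\<close> and \<open>f = id\<close>. Parametrization by open plane sets excludes a boundary.\<close>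

definition local_param ::
    "'a topology \<Rightarrow> ('a \<Rightarrow> real^3) \<Rightarrow> (real^2) set \<Rightarrow> (real^2 \<Rightarrow> 'a) \<Rightarrow> bool" where
  "local_param X f U \<phi> \<longleftrightarrow>
     open U \<and> openin X (\<phi> ` U) \<and>
     homeomorphic_map (top_of_set U) (subtopology X (\<phi> ` U)) \<phi> \<and>
     smooth_on U (f \<circ> \<phi>) \<and>
     (\<forall>u\<in>U. inj (frechet_derivative (f \<circ> \<phi>) (at u)))"

definition immersed_surface :: "'a topology \<Rightarrow> ('a \<Rightarrow> real^3) \<Rightarrow> bool" where
  "immersed_surface X f \<longleftrightarrow>
     Hausdorff_space X \<and> second_countable X \<and>
     (\<forall>p\<in>topspace X. \<exists>U \<phi>. local_param X f U \<phi> \<and> p \<in> \<phi> ` U)"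

text \<open>The tangent plane is a linear plane through the origin.\<close>

definition tangent_plane :: "'a topology \<Rightarrow> ('a \<Rightarrow> real^3) \<Rightarrow> 'a \<Rightarrow> (real^3) set" where
  "tangent_plane X f p =
     {frechet_derivative (f \<circ> \<phi>) (at u) w | U \<phi> u w.
        local_param X f U \<phi> \<and> u \<in> U \<and> \<phi> u = p}"

definition smooth_map :: "'a topology \<Rightarrow> ('a \<Rightarrow> real^3) \<Rightarrow> ('a \<Rightarrow> real^3) \<Rightarrow> bool" where
  "smooth_map X f g \<longleftrightarrow> (\<forall>U \<phi>. local_param X f U \<phi> \<longrightarrow> smooth_on U (g \<circ> \<phi>))"

text \<open>\<open>surface_diff X f g p V\<close> is the differential at \<open>p\<close> of a smooth map \<open>g\<close> on the surface,
  applied to a tangent vector \<open>V\<close>; it has no meaning for \<open>V\<close> outside the tangent plane.\<close>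

definition surface_diff ::
    "'a topology \<Rightarrow> ('a \<Rightarrow> real^3) \<Rightarrow> ('a \<Rightarrow> real^3) \<Rightarrow> 'a \<Rightarrow> real^3 \<Rightarrow> real^3" where
  "surface_diff X f g p V =
     (THE Z. \<exists>U \<phi> u w. local_param X f U \<phi> \<and> u \<in> U \<and> \<phi> u = p \<and>
        V = frechet_derivative (f \<circ> \<phi>) (at u) w \<and>
        Z = frechet_derivative (g \<circ> \<phi>) (at u) w)"

text \<open>The determinant of an endomorphism \<open>L\<close> of a plane \<open>T\<close>, as the determinant of its matrix
  with respect to any basis of \<open>T\<close>.\<close>

definition plane_det :: "(real^3) set \<Rightarrow> (real^3 \<Rightarrow> real^3) \<Rightarrow> real" where
  "plane_det T L =
     (THE d. \<exists>(b :: 2 \<Rightarrow> real^3) (A :: real^2^2).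
        inj b \<and> independent (range b) \<and> span (range b) = T \<and>
        (\<forall>j. L (b j) = (\<Sum>i\<in>UNIV. A $ i $ j *\<^sub>R b i)) \<and> d = det A)"

text \<open>Every tangent plane, translated to its point of contact, is a supporting plane that meets
  the surface in that point only. In particular \<open>f\<close> is injective.\<close>

definition strictly_convex_surface :: "'a topology \<Rightarrow> ('a \<Rightarrow> real^3) \<Rightarrow> bool" where
  "strictly_convex_surface X f \<longleftrightarrow>
     (\<forall>p\<in>topspace X. \<exists>\<xi>. (\<forall>V\<in>tangent_plane X f p. \<xi> \<bullet> V = 0) \<and>
        (\<forall>q\<in>topspace X. q \<noteq> p \<longrightarrow> \<xi> \<bullet> (f q - f p) < 0))"

text \<open>For a convex surface: \<open>v\<close> points to the open side of the tangent plane at \<open>p\<close> that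
  contains no point of the surface.\<close>

definition outward :: "'a topology \<Rightarrow> ('a \<Rightarrow> real^3) \<Rightarrow> 'a \<Rightarrow> real^3 \<Rightarrow> bool" where
  "outward X f p v \<longleftrightarrow>
     (\<exists>\<xi>. (\<forall>V\<in>tangent_plane X f p. \<xi> \<bullet> V = 0) \<and>
        (\<forall>q\<in>topspace X. \<xi> \<bullet> (f q - f p) \<le> 0) \<and> 0 < \<xi> \<bullet> v)"

definition euclidean_gauss_map ::
    "'a topology \<Rightarrow> ('a \<Rightarrow> real^3) \<Rightarrow> ('a \<Rightarrow> real^3) \<Rightarrow> bool" where
  "euclidean_gauss_map X f \<nu> \<longleftrightarrow>
     smooth_map X f \<nu> \<and>
     (\<forall>p\<in>topspace X. norm (\<nu> p) = 1 \<and> (\<forall>V\<in>tangent_plane X f p. \<nu> p \<bullet> V = 0) \<and>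
        outward X f p (\<nu> p))"


section \<open>Admissible norms\<close>

definition is_norm :: "(real^3 \<Rightarrow> real) \<Rightarrow> bool" where
  "is_norm N \<longleftrightarrow>
     (\<forall>x. 0 \<le> N x) \<and> (\<forall>x. N x = 0 \<longleftrightarrow> x = 0) \<and>
     (\<forall>a x. N (a *\<^sub>R x) = \<bar>a\<bar> * N x) \<and> (\<forall>x y. N (x + y) \<le> N x + N y)"

definition unit_sphere :: "(real^3 \<Rightarrow> real) \<Rightarrow> (real^3) set" where
  "unit_sphere N = {x. N x = 1}"

abbreviation sphere_top :: "(real^3 \<Rightarrow> real) \<Rightarrow> (real^3) topology" where
  "sphere_top N \<equiv> top_of_set (unit_sphere N)"

text \<open>The Euclidean Gaussian curvature of the unit sphere is the determinant of the differential
  of its outward Gauss map, which is unique on the sphere.\<close>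

definition admissible_norm :: "(real^3 \<Rightarrow> real) \<Rightarrow> bool" where
  "admissible_norm N \<longleftrightarrow>
     is_norm N \<and> immersed_surface (sphere_top N) id \<and>
     (\<exists>\<nu>. euclidean_gauss_map (sphere_top N) id \<nu> \<and>
        (\<forall>x\<in>unit_sphere N.
           0 < plane_det (tangent_plane (sphere_top N) id x) (surface_diff (sphere_top N) id \<nu> x)))"


section \<open>Minkowski geometry of surfaces\<close>

definition birkhoff_orthogonal :: "(real^3 \<Rightarrow> real) \<Rightarrow> real^3 \<Rightarrow> (real^3) set \<Rightarrow> bool" where
  "birkhoff_orthogonal N v P \<longleftrightarrow> v \<noteq> 0 \<and> (\<forall>t. \<forall>w\<in>P. N (v + t *\<^sub>R w) \<ge> N v)"

definition birkhoff_gauss_map ::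
    "(real^3 \<Rightarrow> real) \<Rightarrow> 'a topology \<Rightarrow> ('a \<Rightarrow> real^3) \<Rightarrow> ('a \<Rightarrow> real^3) \<Rightarrow> bool" where
  "birkhoff_gauss_map N X f \<eta> \<longleftrightarrow>
     smooth_map X f \<eta> \<and>
     (\<forall>p\<in>topspace X. \<eta> p \<in> unit_sphere N \<and> birkhoff_orthogonal N (\<eta> p) (tangent_plane X f p) \<and>
        outward X f p (\<eta> p))"

definition minkowski_gauss_curvature ::
    "'a topology \<Rightarrow> ('a \<Rightarrow> real^3) \<Rightarrow> ('a \<Rightarrow> real^3) \<Rightarrow> 'a \<Rightarrow> real" where
  "minkowski_gauss_curvature X f \<eta> p = plane_det (tangent_plane X f p) (surface_diff X f \<eta> p)"

text \<open>Here \<open>\<nu>\<close> stands for the Euclidean Gauss map of the unit sphere. Its differential at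
  \<open>\<eta> p\<close> is applied to vectors tangent to the surface at \<open>p\<close>, which is legitimate because the
  two tangent planes are the same linear plane.\<close>

definition normal_curvature ::
    "(real^3 \<Rightarrow> real) \<Rightarrow> (real^3 \<Rightarrow> real^3) \<Rightarrow> 'a topology \<Rightarrow> ('a \<Rightarrow> real^3) \<Rightarrow> ('a \<Rightarrow> real^3) \<Rightarrow>
      'a \<Rightarrow> real^3 \<Rightarrow> real" where
  "normal_curvature N \<nu> X f \<eta> p V =
     (surface_diff (sphere_top N) id \<nu> (\<eta> p) V \<bullet> surface_diff X f \<eta> p V) /
     (surface_diff (sphere_top N) id \<nu> (\<eta> p) V \<bullet> V)"

definition unit_circle ::
    "(real^3 \<Rightarrow> real) \<Rightarrow> 'a topology \<Rightarrow> ('a \<Rightarrow> real^3) \<Rightarrow> 'a \<Rightarrow> (real^3) set" where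
  "unit_circle N X f p = {V \<in> tangent_plane X f p. N V = 1}"

definition supporting_plane :: "'a topology \<Rightarrow> ('a \<Rightarrow> real^3) \<Rightarrow> (real^3) set \<Rightarrow> bool" where
  "supporting_plane X f P \<longleftrightarrow>
     (\<exists>\<xi> p. \<xi> \<noteq> 0 \<and> p \<in> topspace X \<and> P = {x. \<xi> \<bullet> x = \<xi> \<bullet> f p} \<and>
        (\<forall>q\<in>topspace X. \<xi> \<bullet> f q \<le> \<xi> \<bullet> f p))"

definition norm_setdist :: "(real^3 \<Rightarrow> real) \<Rightarrow> (real^3) set \<Rightarrow> (real^3) set \<Rightarrow> real" where
  "norm_setdist N P Q = Inf {N (x - y) | x y. x \<in> P \<and> y \<in> Q}"

definition constant_minkowski_width ::
    "(real^3 \<Rightarrow> real) \<Rightarrow> 'a topology \<Rightarrow> ('a \<Rightarrow> real^3) \<Rightarrow> real \<Rightarrow> bool" where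
  "constant_minkowski_width N X f c \<longleftrightarrow>
     (\<forall>P Q. supporting_plane X f P \<and> supporting_plane X f Q \<and> P \<noteq> Q \<and> affine_parallel P Q
        \<longrightarrow> norm_setdist N P Q = c)"

end

theory Submission
  imports Defs
begin

text \<open>Write \<open>T = tangent_plane X f p\<close> and let \<open>q\<close> be the other point with this tangent plane. Since the
  surface is strictly convex, its outward unit normals at \<open>p\<close> and \<open>q\<close> are opposite, and
  \<open>n = \<nu> \<circ> \<eta>\<close> is the Euclidean Gauss map of the surface.

  \<^emph>\<open>The width condition fixes the chord.\<close> The width in the direction \<open>\<nu> x\<close> is the support function
  of \<open>f(X) - f(X)\<close> at \<open>\<nu> x\<close>, divided by the dual norm \<open>\<nu> x \<bullet> x\<close>. Constant width therefore says that
  \<open>f(X) - f(X)\<close> has the same support function as the ball of radius \<open>c\<close>, so that \<open>f p - f q\<close> lies in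
  this ball and on its supporting plane with normal \<open>n p\<close>. Positive Gaussian curvature makes the ball
  strictly convex (\<open>gauss_map_injective\<close>), and the plane touches it in \<open>c \<eta>(p)\<close> only. Hence
  \<open>f p - f q = c \<eta>(p)\<close> and \<open>\<eta>(q) = - \<eta>(p)\<close> for all antipodal pairs
  (\<open>antipodal_difference\<close>, \<open>eta_antipodal\<close>).

  \<^emph>\<open>Differentiate the chord.\<close> Move \<open>p\<close> with velocity \<open>V\<close>; the antipodal point then moves with velocity
  \<open>V - c d\<eta>\<^sub>p V\<close>, and its image under \<open>\<eta>\<close> with velocity \<open>- d\<eta>\<^sub>p V\<close>. This gives
  \<open>d\<eta>\<^sub>q (V - c d\<eta>\<^sub>p V) = - d\<eta>\<^sub>p V\<close> (\<open>antipodal_derivative\<close>), in other words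
  \<open>(d\<eta>\<^sub>p)\<^sup>-\<^sup>1 + (d\<eta>\<^sub>q)\<^sup>-\<^sup>1 = c\<close> on \<open>T\<close>. So an eigenvector of \<open>d\<eta>\<^sub>p\<close> with eigenvalue \<open>k\<close> is one of
  \<open>d\<eta>\<^sub>q\<close> with eigenvalue \<open>k / (c k - 1)\<close>, and conversely.

  \<^emph>\<open>Extremal normal curvatures are eigenvalues.\<close> With \<open>A = d\<nu>\<close> at \<open>\<eta>(p)\<close> and \<open>B = d\<eta>\<^sub>p\<close>, the normal
  curvature is the quotient \<open>(A V \<bullet> B V) / (A V \<bullet> V)\<close>. Both \<open>A\<close> and \<open>A \<circ> B = dn\<^sub>p\<close> are differentials of
  unit normals of convex surfaces, hence self-adjoint (symmetry of the second derivatives of a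
  parametrization) and positive definite on \<open>T\<close> (convexity together with the two curvature
  conditions). So the normal curvature is a Rayleigh quotient, whose extrema over the unit circle are attained at
  eigenvectors of \<open>B\<close> (\<open>rayleigh_quotient_extremum\<close>). Comparing the largest eigenvalue at \<open>p\<close> and the
  smallest at \<open>q\<close> through the relation above gives the theorem.\<close>

section \<open>Calculus along curves\<close>

text \<open>The mixed second difference of \<open>g\<close> over the parallelogram with sides \<open>t v\<close> and \<open>t w\<close> is
  \<open>t\<^sup>2 * D w + o(t\<^sup>2)\<close>: the mean value theorem in the direction \<open>v\<close> turns it into a difference of
  values of \<open>\<lambda>x. g' x v\<close>, and this function is differentiable at \<open>u\<close>.\<close>

lemma second_difference_approx:
  fixes g :: "'a::real_normed_vector \<Rightarrow> real"
  assumes U: "open U" "u \<in> U" and g': "\<And>x. x \<in> U \<Longrightarrow> (g has_derivative g' x) (at x)"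
    and D: "((\<lambda>x. g' x v) has_derivative D) (at u)" and "0 < e"
  shows "\<forall>\<^sub>F t in at_right 0.
    \<bar>g (u + t *\<^sub>R v + t *\<^sub>R w) - g (u + t *\<^sub>R v) - g (u + t *\<^sub>R w) + g u - t\<^sup>2 * D w\<bar> \<le> e * t\<^sup>2"
proof -
  \<comment> \<open>\<open>t * K\<close> bounds the distance from \<open>u\<close> of all points that occur below as well as the sum of the two
    error terms; the summand \<open>1\<close> makes \<open>K\<close> positive.\<close>
  define K where "K = 2 * norm v + norm w + 1"
  have K: "K > 0" by (simp add: K_def add_nonneg_pos)
  interpret D: bounded_linear D using D by (rule has_derivative_bounded_linear)
  obtain d1 where d1: "d1 > 0" "ball u d1 \<subseteq> U" using U by (meson openE)
  obtain d2 where d2: "d2 > 0" and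
    D2: "\<And>y. norm (y - u) < d2 \<Longrightarrow> \<bar>g' y v - g' u v - D (y - u)\<bar> \<le> e / K * norm (y - u)"
    using D K \<open>0 < e\<close> unfolding has_derivative_at_alt real_norm_def by (meson divide_pos_pos)
  define b where "b = min d1 d2 / K"
  have "b > 0" using d1 d2 K by (simp add: b_def)
  have "\<bar>g (u + t *\<^sub>R v + t *\<^sub>R w) - g (u + t *\<^sub>R v) - g (u + t *\<^sub>R w) + g u - t\<^sup>2 * D w\<bar> \<le> e * t\<^sup>2"
    if t: "0 < t" "t < b" for t
  proof -
    have tK: "t * K < d1" "t * K < d2" using t K by (auto simp: b_def field_simps)
    have small: "norm (s *\<^sub>R v) \<le> t * norm v" "norm (s *\<^sub>R v + t *\<^sub>R w) \<le> t * (norm v + norm w)"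
      if "0 \<le> s" "s \<le> t" for s
    proof -
      show *: "norm (s *\<^sub>R v) \<le> t * norm v" using that by (simp add: mult_right_mono)
      show "norm (s *\<^sub>R v + t *\<^sub>R w) \<le> t * (norm v + norm w)"
        using norm_triangle_ineq[of "s *\<^sub>R v" "t *\<^sub>R w"] * t by (simp add: algebra_simps)
    qed
    have le: "t * norm v < t * K" "t * (norm v + norm w) < t * K"
      using t norm_ge_zero[of v] norm_ge_zero[of w] unfolding K_def by (auto simp del: norm_ge_zero)
    have inU: "u + s *\<^sub>R v \<in> U" "u + s *\<^sub>R v + t *\<^sub>R w \<in> U" if "0 \<le> s" "s \<le> t" for s
      using small[OF that] le tK d1(2) by (auto simp: subset_iff dist_norm add.assoc simp flip: minus_add_distrib)
    define \<phi> where "\<phi> s = g (u + s *\<^sub>R v + t *\<^sub>R w) - g (u + s *\<^sub>R v)" for s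
    have "(\<phi> has_derivative (\<lambda>h. h * (g' (u + s *\<^sub>R v + t *\<^sub>R w) v - g' (u + s *\<^sub>R v) v))) (at s)"
      if s: "0 \<le> s" "s \<le> t" for s
    proof -
      have l: "bounded_linear (g' (u + s *\<^sub>R v + t *\<^sub>R w))" "bounded_linear (g' (u + s *\<^sub>R v))"
        using g' inU[OF s] has_derivative_bounded_linear by blast+
      have 1: "((\<lambda>s. g (u + s *\<^sub>R v + t *\<^sub>R w)) has_derivative (\<lambda>h. g' (u + s *\<^sub>R v + t *\<^sub>R w) (h *\<^sub>R v))) (at s)"
        by (rule has_derivative_compose[where f = "\<lambda>s. u + s *\<^sub>R v + t *\<^sub>R w" and g = g])
          (use g'[OF inU(2)[OF s]] in \<open>auto intro!: derivative_eq_intros\<close>)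
      have 2: "((\<lambda>s. g (u + s *\<^sub>R v)) has_derivative (\<lambda>h. g' (u + s *\<^sub>R v) (h *\<^sub>R v))) (at s)"
        by (rule has_derivative_compose[where f = "\<lambda>s. u + s *\<^sub>R v" and g = g])
          (use g'[OF inU(1)[OF s]] in \<open>auto intro!: derivative_eq_intros\<close>)
      show ?thesis
        using has_derivative_diff[OF 1 2]
        by (simp add: \<phi>_def[abs_def] linear_cmul[OF bounded_linear.linear[OF l(1)]]
            linear_cmul[OF bounded_linear.linear[OF l(2)]] right_diff_distrib)
    qed
    then have "\<exists>\<theta>\<in>{0<..<t}. \<phi> t - \<phi> 0 = (t - 0) * (g' (u + \<theta> *\<^sub>R v + t *\<^sub>R w) v - g' (u + \<theta> *\<^sub>R v) v)"
      by (intro mvt_simple) (use t in \<open>auto intro: has_derivative_at_withinI\<close>)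
    then obtain \<theta> where \<theta>: "0 < \<theta>" "\<theta> < t"
      and mv: "\<phi> t - \<phi> 0 = t * (g' (u + \<theta> *\<^sub>R v + t *\<^sub>R w) v - g' (u + \<theta> *\<^sub>R v) v)"
      by auto
    have n1: "norm (\<theta> *\<^sub>R v) \<le> t * norm v" and n2: "norm (\<theta> *\<^sub>R v + t *\<^sub>R w) \<le> t * (norm v + norm w)"
      using small[of \<theta>] \<theta> by auto
    have e1: "\<bar>g' (u + \<theta> *\<^sub>R v) v - g' u v - D (\<theta> *\<^sub>R v)\<bar> \<le> e / K * (t * norm v)"
      using D2[of "u + \<theta> *\<^sub>R v"] n1 le(1) tK mult_left_mono[OF n1, of "e / K"] K \<open>0 < e\<close> by simp
    have e2: "\<bar>g' (u + \<theta> *\<^sub>R v + t *\<^sub>R w) v - g' u v - D (\<theta> *\<^sub>R v + t *\<^sub>R w)\<bar> \<le> e / K * (t * (norm v + norm w))"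
      using D2[of "u + \<theta> *\<^sub>R v + t *\<^sub>R w"] n2 le(2) tK mult_left_mono[OF n2, of "e / K"] K \<open>0 < e\<close>
      by (simp add: add.assoc)
    have "D (\<theta> *\<^sub>R v + t *\<^sub>R w) = D (\<theta> *\<^sub>R v) + t * D w" by (simp add: D.add D.scaleR)
    then have "\<bar>g' (u + \<theta> *\<^sub>R v + t *\<^sub>R w) v - g' (u + \<theta> *\<^sub>R v) v - t * D w\<bar>
        \<le> e / K * (t * norm v) + e / K * (t * (norm v + norm w))"
      using e1 e2 by linarith
    also have "\<dots> = e * t * ((2 * norm v + norm w) / K)" by (simp add: algebra_simps add_divide_distrib)
    also have "\<dots> \<le> e * t * 1" using K t \<open>0 < e\<close> by (intro mult_left_mono) (auto simp: K_def)
    finally have "t * \<bar>g' (u + \<theta> *\<^sub>R v + t *\<^sub>R w) v - g' (u + \<theta> *\<^sub>R v) v - t * D w\<bar> \<le> t * (e * t)"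
      using t by (intro mult_left_mono) auto
    then have "\<bar>t * (g' (u + \<theta> *\<^sub>R v + t *\<^sub>R w) v - g' (u + \<theta> *\<^sub>R v) v - t * D w)\<bar> \<le> t * (e * t)"
      using t by (simp add: abs_mult)
    moreover have "t * (g' (u + \<theta> *\<^sub>R v + t *\<^sub>R w) v - g' (u + \<theta> *\<^sub>R v) v - t * D w)
        = \<phi> t - \<phi> 0 - t\<^sup>2 * D w"
      unfolding mv by (simp add: algebra_simps power2_eq_square)
    ultimately show ?thesis
      by (simp add: \<phi>_def power2_eq_square algebra_simps)
  qed
  then show ?thesis using \<open>b > 0\<close> by (auto simp: eventually_at_right_field)
qed

text \<open>The mixed second difference does not change when \<open>v\<close> and \<open>w\<close> are exchanged, so both mixed
  derivatives are the limit of the same quotient.\<close>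

lemma second_derivative_symmetric:
  fixes g :: "'a::real_normed_vector \<Rightarrow> real"
  assumes U: "open U" "u \<in> U" and g': "\<And>x. x \<in> U \<Longrightarrow> (g has_derivative g' x) (at x)"
    and Dv: "((\<lambda>x. g' x v) has_derivative Dv) (at u)" and Dw: "((\<lambda>x. g' x w) has_derivative Dw) (at u)"
  shows "Dv w = Dw v"
proof -
  have "\<bar>Dv w - Dw v\<bar> \<le> 0 + e" if "e > 0" for e
  proof -
    have "\<forall>\<^sub>F t in at_right (0::real). \<bar>Dv w - Dw v\<bar> \<le> e"
    proof -
      have "\<forall>\<^sub>F t in at_right 0. \<bar>g (u + t *\<^sub>R v + t *\<^sub>R w) - g (u + t *\<^sub>R v) - g (u + t *\<^sub>R w) + g u - t\<^sup>2 * Dv w\<bar> \<le> e / 2 * t\<^sup>2"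
        using U g' Dv half_gt_zero[OF that] by (rule second_difference_approx)
      moreover have "\<forall>\<^sub>F t in at_right 0. \<bar>g (u + t *\<^sub>R w + t *\<^sub>R v) - g (u + t *\<^sub>R w) - g (u + t *\<^sub>R v) + g u - t\<^sup>2 * Dw v\<bar> \<le> e / 2 * t\<^sup>2"
        using U g' Dw half_gt_zero[OF that] by (rule second_difference_approx)
      moreover note eventually_at_right_less[of 0]
      ultimately show ?thesis
      proof eventually_elim
        case (elim t)
        have "\<bar>t\<^sup>2 * Dv w - t\<^sup>2 * Dw v\<bar> \<le> e * t\<^sup>2"
          using elim(1,2) unfolding add.assoc add.commute[of "t *\<^sub>R w"] by linarith
        then have "t\<^sup>2 * \<bar>Dv w - Dw v\<bar> \<le> t\<^sup>2 * e"
          by (simp add: abs_mult flip: right_diff_distrib) (simp add: mult.commute)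
        then show ?case using elim(3) by simp
      qed
    qed
    then show ?thesis by (simp add: eventually_const_iff)
  qed
  then show ?thesis using field_le_epsilon[of "\<bar>Dv w - Dw v\<bar>" 0] by auto
qed

lemma has_vector_derivative_compose:
  assumes c: "(c has_vector_derivative w) (at t)" and F: "(F has_derivative D) (at (c t))"
  shows "((\<lambda>s. F (c s)) has_vector_derivative D w) (at t)"
  using has_derivative_compose[where f = c and g = F, OF c[unfolded has_vector_derivative_def] F]
  by (simp add: has_vector_derivative_def linear_cmul[OF has_derivative_linear[OF F]])

lemma has_vector_derivative_transform_eventually:
  assumes "(g has_vector_derivative D) (at x)" and "\<forall>\<^sub>F t in at x. g t = h t" and "g x = h x"
  shows "(h has_vector_derivative D) (at x)"
  using assms has_derivative_transform_eventually[of g _ x UNIV h]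
  by (simp add: has_vector_derivative_def)

lemma has_vector_derivative_imp_tendsto:
  "(g has_vector_derivative D) (at x) \<Longrightarrow> (g \<longlongrightarrow> g x) (at x)"
  using has_vector_derivative_continuous continuous_at by (metis isCont_def)

lemma has_vector_derivative_imp_quotient:
  assumes "(g has_vector_derivative D) (at 0)"
  shows "((\<lambda>t. (1/t) *\<^sub>R (g t - g 0)) \<longlongrightarrow> D) (at (0::real))"
proof -
  have "((\<lambda>t. norm (g t - g 0 - t *\<^sub>R D) / norm t) \<longlongrightarrow> 0) (at 0)"
    using assms unfolding has_vector_derivative_def has_derivative_iff_norm by simp
  moreover have "\<forall>\<^sub>F t in at (0::real). norm (g t - g 0 - t *\<^sub>R D) / norm t = norm ((1/t) *\<^sub>R (g t - g 0) - D)"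
    unfolding eventually_at_filter
  proof (intro always_eventually allI impI)
    fix t :: real assume "t \<noteq> 0"
    then have "(1/t) *\<^sub>R (g t - g 0) - D = (1/t) *\<^sub>R (g t - g 0 - t *\<^sub>R D)"
      by (simp add: scaleR_diff_right)
    then show "norm (g t - g 0 - t *\<^sub>R D) / norm t = norm ((1/t) *\<^sub>R (g t - g 0) - D)" by simp
  qed
  ultimately have "((\<lambda>t. norm ((1/t) *\<^sub>R (g t - g 0) - D)) \<longlongrightarrow> 0) (at 0)"
    by (rule Lim_transform_eventually)
  then show ?thesis by (simp add: tendsto_norm_zero_iff LIM_zero_iff)
qed

text \<open>Differentiability passes from \<open>F \<circ> c\<close> to \<open>c\<close> when \<open>c\<close> is merely continuous at \<open>0\<close>: after composition
  with a left inverse of \<open>D\<close>, the map \<open>F\<close> is tangent to the identity at \<open>u\<close>. This first shows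
  \<open>c t - u = O(t)\<close>, and then that the remainder \<open>o(c t - u)\<close> is \<open>o(t)\<close>.\<close>

lemma has_vector_derivative_pull_back:
  fixes F :: "'a::euclidean_space \<Rightarrow> 'b::euclidean_space" and c :: "real \<Rightarrow> 'a"
  assumes F: "(F has_derivative D) (at u)" and "inj D"
    and c: "(c \<longlongrightarrow> u) (at 0)" "c 0 = u"
    and V: "((\<lambda>t. F (c t)) has_vector_derivative V) (at 0)"
  shows "\<exists>w. D w = V \<and> (c has_vector_derivative w) (at 0)"
proof -
  have linD: "linear D" using F has_derivative_linear by blast
  obtain G where G: "linear G" "G \<circ> D = id" using linear_injective_left_inverse[OF linD \<open>inj D\<close>] by blast
  interpret G: bounded_linear G using G(1) by (rule linear_linear[THEN iffD2])
  define h where "h x = G (F x)" for x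
  have h: "(h has_derivative (\<lambda>x. x)) (at u)"
    using G.has_derivative[OF F] G(2) by (simp add: h_def[abs_def] o_def fun_eq_iff id_def)
  have hc: "((\<lambda>t. h (c t)) has_derivative (\<lambda>t. t *\<^sub>R G V)) (at 0)"
    using G.has_derivative[OF V[unfolded has_vector_derivative_def]] by (simp add: h_def G.scaleR)
  define w where "w = G V"
  \<comment> \<open>The tolerance \<open>1/2\<close> gives the a priori bound \<open>norm (c t - u) \<le> 2 * norm (h (c t) - h u)\<close>.\<close>
  obtain d1 where d1: "d1 > 0" and H1: "\<And>y. norm (y - u) < d1 \<Longrightarrow> norm (h y - h u - (y - u)) \<le> 1/2 * norm (y - u)"
    using h unfolding has_derivative_at_alt by (meson half_gt_zero_iff zero_less_one)
  obtain d2 where d2: "d2 > 0" and H2: "\<And>t. \<bar>t\<bar> < d2 \<Longrightarrow> norm (h (c t) - h u - t *\<^sub>R w) \<le> 1 * \<bar>t\<bar>"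
    using hc c(2) unfolding has_derivative_at_alt w_def by (metis diff_zero real_norm_def zero_less_one)
  have "(c has_derivative (\<lambda>t. t *\<^sub>R w)) (at 0)"
    unfolding has_derivative_at_alt
  proof (intro conjI allI impI)
    show "bounded_linear (\<lambda>t. t *\<^sub>R w)" by (rule bounded_linear_scaleR_left)
    fix e :: real assume "e > 0"
    define K where "K = 2 * (norm w + 1)"
    have K: "K > 0" by (simp add: K_def add_nonneg_pos)
    obtain d3 where d3: "d3 > 0" and H3: "\<And>y. norm (y - u) < d3 \<Longrightarrow> norm (h y - h u - (y - u)) \<le> e / (2 * K) * norm (y - u)"
      using h K \<open>e > 0\<close> unfolding has_derivative_at_alt by (metis divide_pos_pos mult_pos_pos zero_less_numeral)
    obtain d4 where d4: "d4 > 0" and H4: "\<And>t. \<bar>t\<bar> < d4 \<Longrightarrow> norm (h (c t) - h u - t *\<^sub>R w) \<le> e / 2 * \<bar>t\<bar>"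
      using hc c(2) \<open>e > 0\<close> unfolding has_derivative_at_alt w_def by (metis diff_zero real_norm_def half_gt_zero)
    obtain d5 where d5: "d5 > 0" and H5: "\<And>t. t \<noteq> 0 \<Longrightarrow> \<bar>t\<bar> < d5 \<Longrightarrow> norm (c t - u) < min d1 d3"
      using c(1) d1 d3 unfolding tendsto_iff eventually_at dist_norm real_norm_def
      by (metis UNIV_I diff_zero min_less_iff_conj)
    have "norm (c t - c 0 - (t - 0) *\<^sub>R w) \<le> e * norm (t - 0)"
      if t: "norm (t - 0) < min (min d2 d4) d5" for t
    proof (cases "t = 0")
      case False
      define x where "x = h (c t) - h u"
      define y where "y = c t - u"
      have y: "norm (c t - u) < d1" "norm (c t - u) < d3" using H5[OF False] t by auto
      have 1: "norm (x - y) \<le> 1/2 * norm y" "norm (x - y) \<le> e / (2 * K) * norm y"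
        using H1[OF y(1)] H3[OF y(2)] by (auto simp: x_def y_def)
      have 2: "norm (x - t *\<^sub>R w) \<le> \<bar>t\<bar>" "norm (x - t *\<^sub>R w) \<le> e / 2 * \<bar>t\<bar>"
        using H2[of t] H4[of t] t by (auto simp: x_def)
      have "norm x \<le> \<bar>t\<bar> * (norm w + 1)"
        using 2(1) norm_triangle_ineq2[of x "t *\<^sub>R w"] by (simp add: algebra_simps)
      moreover have "norm y \<le> 2 * norm x"
        using 1(1) norm_triangle_ineq2[of y x] by (simp add: norm_minus_commute)
      ultimately have "norm y \<le> K * \<bar>t\<bar>" by (simp add: K_def algebra_simps)
      then have "e / (2 * K) * norm y \<le> e / (2 * K) * (K * \<bar>t\<bar>)" using \<open>e > 0\<close> K by (intro mult_left_mono) auto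
      also have "\<dots> = e / 2 * \<bar>t\<bar>" using K by simp
      finally have "norm (x - y) \<le> e / 2 * \<bar>t\<bar>" using 1(2) by linarith
      then have "norm (y - t *\<^sub>R w) \<le> e / 2 * \<bar>t\<bar> + e / 2 * \<bar>t\<bar>"
        using 2(2) norm_triangle_ineq[of "y - x" "x - t *\<^sub>R w"] by (simp add: norm_minus_commute)
      then show ?thesis by (simp add: y_def c(2))
    qed auto
    then show "\<exists>d>0. \<forall>y. norm (y - 0) < d \<longrightarrow> norm (c y - c 0 - (y - 0) *\<^sub>R w) \<le> e * norm (y - 0)"
      using d2 d4 d5 by (intro exI[of _ "min (min d2 d4) d5"]) auto
  qed
  then have cw: "(c has_vector_derivative w) (at 0)" by (simp add: has_vector_derivative_def)
  have "((\<lambda>t. F (c t)) has_vector_derivative D w) (at 0)"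
    by (rule has_vector_derivative_compose[OF cw]) (use F c(2) in simp)
  then have "D w = V" using V vector_derivative_unique_at by blast
  then show ?thesis using cw by blast
qed

section \<open>Linear algebra of symmetric forms and hyperplanes\<close>

text \<open>The degenerate case of the Cauchy-Schwarz inequality for a positive semidefinite form that is only
  controlled on a subspace.\<close>

lemma nonneg_form_null_vector:
  fixes M :: "'a::euclidean_space \<Rightarrow> 'a"
  assumes T: "subspace T" and M: "linear M" and sym: "\<And>V W. V \<in> T \<Longrightarrow> W \<in> T \<Longrightarrow> M V \<bullet> W = M W \<bullet> V"
    and nonneg: "\<And>V. V \<in> T \<Longrightarrow> 0 \<le> M V \<bullet> V"
    and V: "V \<in> T" "M V \<bullet> V = 0" and W: "W \<in> T"
  shows "M V \<bullet> W = 0"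
proof (rule ccontr)
  define a where "a = M V \<bullet> W"
  define b where "b = M W \<bullet> W"
  assume "M V \<bullet> W \<noteq> 0"
  then have a: "0 < a\<^sup>2" by (simp add: a_def)
  have b: "0 \<le> b" unfolding b_def by (rule nonneg[OF W])
  \<comment> \<open>\<open>t = - a / b\<close> would minimize the quadratic polynomial; \<open>b + 1\<close> also covers \<open>b = 0\<close>.\<close>
  define r where "r = 1 / (b + 1)"
  define t where "t = - a * r"
  have "0 \<le> M (V + t *\<^sub>R W) \<bullet> (V + t *\<^sub>R W)" using T V(1) W by (intro nonneg) (simp add: subspace_add subspace_scale)
  also have "\<dots> = 2 * t * a + t\<^sup>2 * b"
    using V(2) sym[OF V(1) W]
    by (simp add: linear_add[OF M] linear_cmul[OF M] inner_add_left inner_add_right a_def b_def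
        power2_eq_square algebra_simps)
  also have "\<dots> = a\<^sup>2 * r * (b * r - 2)" by (simp add: t_def power2_eq_square algebra_simps)
  also have "\<dots> < 0" using a b by (intro mult_pos_neg mult_pos_pos) (auto simp: r_def field_simps)
  finally show False by simp
qed

lemma orthogonal_to_hyperplane_imp_multiple:
  fixes m n :: "'a::euclidean_space"
  assumes "norm n = 1" and "\<And>V. n \<bullet> V = 0 \<Longrightarrow> m \<bullet> V = 0"
  shows "m = (m \<bullet> n) *\<^sub>R n"
proof -
  let ?b = "m - (m \<bullet> n) *\<^sub>R n"
  have "n \<bullet> n = 1" using assms(1) by (simp add: norm_eq_1)
  then have "n \<bullet> ?b = 0" by (simp add: inner_diff_right inner_commute)
  then have "?b \<bullet> ?b = 0" using assms(2)[of ?b] by (simp add: inner_diff_left)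
  then show ?thesis by simp
qed

text \<open>The coordinates of \<open>V\<close> form a non-zero vector in the kernel of the matrix.\<close>

lemma singular_representing_matrix:
  fixes b :: "2 \<Rightarrow> real^3" and A :: "real^2^2"
  assumes b: "inj b" "independent (range b)" and L: "linear L"
    and A: "\<And>j. L (b j) = (\<Sum>i\<in>UNIV. A $ i $ j *\<^sub>R b i)"
    and V: "V \<in> span (range b)" "V \<noteq> 0" "L V = 0"
  shows "det A = 0"
proof -
  obtain r where "V = (\<Sum>v\<in>range b. r v *\<^sub>R v)" using V(1) by (auto simp: span_finite)
  then have V_eq: "V = (\<Sum>j\<in>UNIV. r (b j) *\<^sub>R b j)" by (simp add: sum.reindex[OF b(1)])
  define x :: "real^2" where "x = (\<chi> j. r (b j))"
  have "x \<noteq> 0"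
  proof
    assume "x = 0"
    then have "r (b j) = 0" for j by (simp add: x_def vec_eq_iff)
    then show False using V(2) V_eq by simp
  qed
  have "0 = (\<Sum>j\<in>UNIV. r (b j) *\<^sub>R (\<Sum>i\<in>UNIV. A $ i $ j *\<^sub>R b i))"
    using V(3) by (simp add: V_eq linear_sum[OF L] linear_cmul[OF L] A)
  also have "\<dots> = (\<Sum>j\<in>UNIV. \<Sum>i\<in>UNIV. (r (b j) * A $ i $ j) *\<^sub>R b i)"
    by (simp add: scaleR_sum_right)
  also have "\<dots> = (\<Sum>i\<in>UNIV. \<Sum>j\<in>UNIV. (r (b j) * A $ i $ j) *\<^sub>R b i)"
    by (rule sum.swap)
  also have "\<dots> = (\<Sum>i\<in>UNIV. (A *v x) $ i *\<^sub>R b i)"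
    by (simp add: matrix_vector_mult_def x_def scaleR_sum_left mult.commute)
  finally have zero: "(\<Sum>i\<in>UNIV. (A *v x) $ i *\<^sub>R b i) = 0" by simp
  have "(\<Sum>v\<in>range b. (A *v x) $ (inv b v) *\<^sub>R v) = 0" using zero by (simp add: sum.reindex[OF b(1)] b(1))
  then have "(A *v x) $ (inv b v) = 0" if "v \<in> range b" for v
    using that by (intro independentD[OF b(2), where t = "range b" and u = "\<lambda>v. (A *v x) $ (inv b v)"]) simp_all
  then have "(A *v x) $ i = 0" for i using inv_f_f[OF b(1)] by (metis rangeI)
  then have Ax: "A *v x = 0" by (simp add: vec_eq_iff)
  show "det A = 0"
  proof (rule ccontr)
    assume "det A \<noteq> 0"
    then obtain A' where "A' ** A = mat 1" by (auto simp flip: invertible_det_nz simp: invertible_def)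
    then have "x = A' *v (A *v x)" by (simp add: matrix_vector_mul_assoc)
    then show False using Ax \<open>x \<noteq> 0\<close> by simp
  qed
qed

text \<open>If \<open>L\<close> had a kernel on \<open>T\<close>, all matrices that represent it would be singular. Then the value \<open>0\<close>
  would be the only candidate in the description that defines \<open>plane_det\<close>, and a basis of \<open>T\<close> shows
  that it is one.\<close>

lemma plane_det_positive_imp_injective:
  assumes T: "subspace T" "dim T = 2" and L: "linear L" and LT: "\<And>V. V \<in> T \<Longrightarrow> L V \<in> T"
    and M: "\<And>V. V \<in> T \<Longrightarrow> M V = L V"
    and pos: "0 < plane_det T M" and V: "V \<in> T" "L V = 0"
  shows "V = 0"
proof (rule ccontr)
  assume "V \<noteq> 0"
  have zero: "det A = 0"
    if "inj b" "independent (range b)" "span (range b) = T" "\<forall>j. M (b j) = (\<Sum>i\<in>UNIV. A $ i $ j *\<^sub>R b i)"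
    for b :: "2 \<Rightarrow> real^3" and A :: "real^2^2"
  proof (rule singular_representing_matrix[OF that(1,2) L])
    show "L (b j) = (\<Sum>i\<in>UNIV. A $ i $ j *\<^sub>R b i)" for j
      using that(3,4) M[of "b j"] by (metis rangeI span_base)
  qed (use that(3) V \<open>V \<noteq> 0\<close> in auto)
  obtain B where B: "B \<subseteq> T" "independent B" "T \<subseteq> span B" "card B = 2"
    using basis_exists[of T] T(2) by metis
  have "finite B" using B(2) independent_imp_finite by blast
  then have "\<exists>b :: 2 \<Rightarrow> real^3. bij_betw b UNIV B" using B(4) by (intro finite_same_card_bij) auto
  then obtain b :: "2 \<Rightarrow> real^3" where "bij_betw b UNIV B" by blast
  then have inj: "inj b" and rb: "range b = B" by (auto simp: bij_betw_def)
  have sp: "span B = T" using B T(1) by (simp add: span_minimal subset_antisym)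
  have "\<exists>r. L (b j) = (\<Sum>i\<in>UNIV. r i *\<^sub>R b i)" for j
  proof -
    have "L (b j) \<in> span (range b)" using LT B(1) rb sp by blast
    then obtain r where "L (b j) = (\<Sum>v\<in>range b. r v *\<^sub>R v)" by (auto simp: span_finite)
    then have "L (b j) = (\<Sum>i\<in>UNIV. r (b i) *\<^sub>R b i)" by (simp add: sum.reindex[OF inj])
    then show ?thesis by (rule exI[where x = "\<lambda>i. r (b i)"])
  qed
  then obtain r where r: "\<And>j. L (b j) = (\<Sum>i\<in>UNIV. r j i *\<^sub>R b i)" by metis
  define A :: "real^2^2" where "A = (\<chi> i j. r j i)"
  have A: "\<forall>j. M (b j) = (\<Sum>i\<in>UNIV. A $ i $ j *\<^sub>R b i)"
  proof
    fix j
    have "b j \<in> T" using B(1) rb by blast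
    then show "M (b j) = (\<Sum>i\<in>UNIV. A $ i $ j *\<^sub>R b i)" using M r by (simp add: A_def)
  qed
  have "plane_det T M = 0"
    unfolding plane_det_def
  proof (rule the_equality)
    show "\<exists>b (A :: real^2^2). inj b \<and> independent (range b) \<and> span (range b) = T \<and>
        (\<forall>j. M (b j) = (\<Sum>i\<in>UNIV. A $ i $ j *\<^sub>R b i)) \<and> 0 = det A"
      using inj B(2) rb sp A zero[of b A] by (intro exI[of _ b] exI[of _ A]) auto
  qed (use zero in blast)
  then show False using pos by simp
qed

section \<open>Tangent planes and differentials of immersed surfaces\<close>

lemma smooth_on_has_derivative:
  assumes "smooth_on U g" and "u \<in> U"
  shows "(g has_derivative frechet_derivative g (at u)) (at u)"
proof -
  have "Ck_on (Suc 0) U g" using assms(1) by (simp only: smooth_on_def)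
  then show ?thesis using assms(2) by (simp add: frechet_derivative_works)
qed

lemma smooth_on_frechet_derivative:
  assumes "smooth_on U g"
  shows "smooth_on U (\<lambda>x. frechet_derivative g (at x) v)"
  unfolding smooth_on_def
proof
  fix k
  have "Ck_on (Suc k) U g" using assms by (simp only: smooth_on_def)
  then show "Ck_on k U (\<lambda>x. frechet_derivative g (at x) v)" by simp
qed

text \<open>Tangent vectors are handled as velocities of curves. Only convergence in the topology of \<open>X\<close> at
  the parameter \<open>0\<close> is asked for, so such a curve may be arbitrary away from \<open>0\<close>: it need not be
  continuous there, nor stay in a chart.\<close>

definition surface_curve :: "'a topology \<Rightarrow> ('a \<Rightarrow> real^3) \<Rightarrow> 'a \<Rightarrow> real^3 \<Rightarrow> (real \<Rightarrow> 'a) \<Rightarrow> bool" where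
  "surface_curve X f p V \<gamma> \<longleftrightarrow>
     limitin X \<gamma> p (at 0) \<and> \<gamma> 0 = p \<and> ((\<lambda>t. f (\<gamma> t)) has_vector_derivative V) (at 0)"

text \<open>The differential of \<open>g\<close> at \<open>p\<close>, characterized by its effect on velocities. No chart occurs, which
  makes the chain rule immediate. The map \<open>L\<close> is linear on the whole space, but only its values on
  the tangent plane are determined.\<close>

definition has_surface_derivative ::
    "'a topology \<Rightarrow> ('a \<Rightarrow> real^3) \<Rightarrow> ('a \<Rightarrow> real^3) \<Rightarrow> 'a \<Rightarrow> (real^3 \<Rightarrow> real^3) \<Rightarrow> bool" where
  "has_surface_derivative X f g p L \<longleftrightarrow> linear L \<and>
     (\<forall>\<gamma> V. surface_curve X f p V \<gamma> \<longrightarrow> ((\<lambda>t. g (\<gamma> t)) has_vector_derivative L V) (at 0))"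

lemma has_surface_derivativeD:
  assumes "has_surface_derivative X f g p L" and "surface_curve X f p V \<gamma>"
  shows "((\<lambda>t. g (\<gamma> t)) has_vector_derivative L V) (at 0)"
  using assms unfolding has_surface_derivative_def by blast

lemma eventually_surface_curve:
  assumes "surface_curve X f p V \<gamma>"
  shows "\<forall>\<^sub>F t in at 0. \<gamma> t \<in> topspace X"
  using assms openin_topspace unfolding surface_curve_def limitin_def by blast

text \<open>A curve through \<open>\<phi> u\<close> eventually stays in the open image of \<open>\<phi>\<close>, and the coordinates of its points
  converge because \<open>\<phi>\<close> is a homeomorphism; the coordinate curve is then differentiable because
  \<open>f \<circ> \<phi>\<close> is an immersion.\<close>

lemma surface_curve_pull_back:
  assumes \<phi>: "local_param X f U \<phi>" and u: "u \<in> U" and \<gamma>: "surface_curve X f (\<phi> u) V \<gamma>"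
  shows "\<exists>w c. (c has_vector_derivative w) (at 0) \<and> c 0 = u \<and>
    V = frechet_derivative (f \<circ> \<phi>) (at u) w \<and> (\<forall>\<^sub>F t in at 0. \<gamma> t = \<phi> (c t))"
proof -
  let ?Y = "subtopology X (\<phi> ` U)"
  have op: "openin X (\<phi> ` U)" and hom: "homeomorphic_map (top_of_set U) ?Y \<phi>"
    and sm: "smooth_on U (f \<circ> \<phi>)" and inj: "inj (frechet_derivative (f \<circ> \<phi>) (at u))"
    using \<phi> u by (auto simp: local_param_def)
  obtain \<psi> where "homeomorphic_maps (top_of_set U) ?Y \<phi> \<psi>"
    using hom homeomorphic_map_maps by blast
  then have \<psi>: "continuous_map ?Y (top_of_set U) \<psi>" and \<psi>\<phi>: "\<And>x. x \<in> U \<Longrightarrow> \<psi> (\<phi> x) = x"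
    by (auto simp: homeomorphic_maps_def)
  define c where "c t = (if \<gamma> t \<in> \<phi> ` U then \<psi> (\<gamma> t) else u)" for t
  have lim: "limitin X \<gamma> (\<phi> u) (at 0)" and \<gamma>0: "\<gamma> 0 = \<phi> u"
    and der: "((\<lambda>t. f (\<gamma> t)) has_vector_derivative V) (at 0)"
    using \<gamma> by (auto simp: surface_curve_def)
  have ev: "\<forall>\<^sub>F t in at 0. \<gamma> t \<in> \<phi> ` U" using lim op u by (auto simp: limitin_def)
  have "limitin ?Y \<gamma> (\<phi> u) (at 0)" using lim ev u by (simp add: limitin_subtopology)
  then have "limitin (top_of_set U) (\<psi> \<circ> \<gamma>) (\<psi> (\<phi> u)) (at 0)" by (rule continuous_map_limit[OF \<psi>])
  then have "((\<psi> \<circ> \<gamma>) \<longlongrightarrow> u) (at 0)" using u by (simp add: limitin_subtopology \<psi>\<phi>)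
  moreover have "\<forall>\<^sub>F t in at 0. (\<psi> \<circ> \<gamma>) t = c t" using ev by eventually_elim (simp add: c_def)
  ultimately have c: "(c \<longlongrightarrow> u) (at 0)" by (rule Lim_transform_eventually)
  have c0: "c 0 = u" using u by (simp add: c_def \<gamma>0 \<psi>\<phi>)
  have \<phi>c: "\<forall>\<^sub>F t in at 0. \<gamma> t = \<phi> (c t)" using ev by eventually_elim (auto simp: c_def \<psi>\<phi>)
  have "((\<lambda>t. (f \<circ> \<phi>) (c t)) has_vector_derivative V) (at 0)"
    by (rule has_vector_derivative_transform_eventually[OF der]) (use \<phi>c \<gamma>0 c0 in \<open>auto elim: eventually_mono\<close>)
  then show ?thesis
    using has_vector_derivative_pull_back[OF smooth_on_has_derivative[OF sm u] inj c c0] c0 \<phi>c by metis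
qed

lemma surface_curve_coordinate:
  assumes \<phi>: "local_param X f U \<phi>" and u: "u \<in> U"
  shows "surface_curve X f (\<phi> u) (frechet_derivative (f \<circ> \<phi>) (at u) w) (\<lambda>t. \<phi> (u + t *\<^sub>R w))"
proof -
  let ?Y = "subtopology X (\<phi> ` U)"
  have U: "open U" and hom: "homeomorphic_map (top_of_set U) ?Y \<phi>" and sm: "smooth_on U (f \<circ> \<phi>)"
    using \<phi> by (auto simp: local_param_def)
  have c: "((\<lambda>t. u + t *\<^sub>R w) \<longlongrightarrow> u) (at 0)" by (auto intro!: tendsto_eq_intros)
  then have "\<forall>\<^sub>F t in at 0. u + t *\<^sub>R w \<in> U" using U u by (rule topological_tendstoD)
  with c have "limitin (top_of_set U) (\<lambda>t. u + t *\<^sub>R w) u (at 0)" using u by (simp add: limitin_subtopology)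
  then have "limitin ?Y (\<phi> \<circ> (\<lambda>t. u + t *\<^sub>R w)) (\<phi> u) (at 0)"
    by (rule continuous_map_limit[OF homeomorphic_imp_continuous_map[OF hom]])
  then have lim: "limitin X (\<lambda>t. \<phi> (u + t *\<^sub>R w)) (\<phi> u) (at 0)"
    by (simp add: limitin_subtopology o_def)
  let ?D = "frechet_derivative (f \<circ> \<phi>) (at u)"
  have D: "((f \<circ> \<phi>) has_derivative ?D) (at u)" by (rule smooth_on_has_derivative[OF sm u])
  have "((\<lambda>t. u + t *\<^sub>R w) has_vector_derivative w) (at 0)" by (auto intro!: derivative_eq_intros)
  then have "((\<lambda>t. (f \<circ> \<phi>) (u + t *\<^sub>R w)) has_vector_derivative ?D w) (at 0)"
    by (rule has_vector_derivative_compose) (use D in \<open>simp add: o_def\<close>)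
  then have "((\<lambda>t. f (\<phi> (u + t *\<^sub>R w))) has_vector_derivative ?D w) (at 0)" by simp
  with lim show ?thesis by (simp add: surface_curve_def)
qed

text \<open>The derivative of \<open>g\<close> along a curve depends on the velocity of the curve only, and can be computed
  in any chart. For this reason \<open>surface_diff\<close> does not depend on the chart.\<close>

lemma coordinate_derivative_of_surface_curve:
  assumes \<phi>: "local_param X f U \<phi>" and u: "u \<in> U" and g: "smooth_on U (g \<circ> \<phi>)"
    and \<gamma>: "surface_curve X f (\<phi> u) (frechet_derivative (f \<circ> \<phi>) (at u) w) \<gamma>"
  shows "((\<lambda>t. g (\<gamma> t)) has_vector_derivative frechet_derivative (g \<circ> \<phi>) (at u) w) (at 0)"
proof -
  let ?D = "frechet_derivative (g \<circ> \<phi>) (at u)"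
  obtain w' c where c: "(c has_vector_derivative w') (at 0)" "c 0 = u"
    and ww': "frechet_derivative (f \<circ> \<phi>) (at u) w = frechet_derivative (f \<circ> \<phi>) (at u) w'"
    and ev: "\<forall>\<^sub>F t in at 0. \<gamma> t = \<phi> (c t)"
    using surface_curve_pull_back[OF \<phi> u \<gamma>] by blast
  have "w' = w" using ww' \<phi> u by (auto simp: local_param_def dest: injD)
  have D: "((g \<circ> \<phi>) has_derivative ?D) (at u)" by (rule smooth_on_has_derivative[OF g u])
  have "((\<lambda>t. (g \<circ> \<phi>) (c t)) has_vector_derivative ?D w) (at 0)"
    using c(1) unfolding \<open>w' = w\<close> by (rule has_vector_derivative_compose) (use D c(2) in \<open>simp add: o_def\<close>)
  moreover have "\<forall>\<^sub>F t in at 0. (g \<circ> \<phi>) (c t) = g (\<gamma> t)" using ev by eventually_elim simp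
  moreover have "(g \<circ> \<phi>) (c 0) = g (\<gamma> 0)" using c(2) \<gamma> by (simp add: surface_curve_def)
  ultimately show ?thesis by (rule has_vector_derivative_transform_eventually)
qed

lemma tangent_plane_eq_range:
  assumes \<phi>: "local_param X f U \<phi>" and u: "u \<in> U"
  shows "tangent_plane X f (\<phi> u) = range (frechet_derivative (f \<circ> \<phi>) (at u))"
proof
  show "range (frechet_derivative (f \<circ> \<phi>) (at u)) \<subseteq> tangent_plane X f (\<phi> u)"
    using assms by (auto simp: tangent_plane_def)
  show "tangent_plane X f (\<phi> u) \<subseteq> range (frechet_derivative (f \<circ> \<phi>) (at u))"
  proof
    fix V assume "V \<in> tangent_plane X f (\<phi> u)"
    then obtain U' \<phi>' u' w where *: "local_param X f U' \<phi>'" "u' \<in> U'" "\<phi>' u' = \<phi> u"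
        "V = frechet_derivative (f \<circ> \<phi>') (at u') w"
      by (auto simp: tangent_plane_def)
    then have "surface_curve X f (\<phi> u) V (\<lambda>t. \<phi>' (u' + t *\<^sub>R w))"
      using surface_curve_coordinate by metis
    then show "V \<in> range (frechet_derivative (f \<circ> \<phi>) (at u))"
      using surface_curve_pull_back[OF \<phi> u] by blast
  qed
qed

lemma surface_diff_coordinate:
  assumes \<phi>: "local_param X f U \<phi>" and u: "u \<in> U" and g: "smooth_map X f g"
  shows "surface_diff X f g (\<phi> u) (frechet_derivative (f \<circ> \<phi>) (at u) w) = frechet_derivative (g \<circ> \<phi>) (at u) w"
  unfolding surface_diff_def
proof (rule the_equality)
  let ?V = "frechet_derivative (f \<circ> \<phi>) (at u) w"
  show "\<exists>U' \<phi>' u' w'. local_param X f U' \<phi>' \<and> u' \<in> U' \<and> \<phi>' u' = \<phi> u \<and>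
      ?V = frechet_derivative (f \<circ> \<phi>') (at u') w' \<and>
      frechet_derivative (g \<circ> \<phi>) (at u) w = frechet_derivative (g \<circ> \<phi>') (at u') w'"
    using \<phi> u by blast
  fix Z
  assume "\<exists>U' \<phi>' u' w'. local_param X f U' \<phi>' \<and> u' \<in> U' \<and> \<phi>' u' = \<phi> u \<and>
      ?V = frechet_derivative (f \<circ> \<phi>') (at u') w' \<and> Z = frechet_derivative (g \<circ> \<phi>') (at u') w'"
  then obtain U' \<phi>' u' w' where \<phi>': "local_param X f U' \<phi>'" and u': "u' \<in> U'" and eq: "\<phi>' u' = \<phi> u"
    and V: "?V = frechet_derivative (f \<circ> \<phi>') (at u') w'" and Z: "Z = frechet_derivative (g \<circ> \<phi>') (at u') w'"
    by blast
  let ?\<gamma> = "\<lambda>t. \<phi> (u + t *\<^sub>R w)"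
  have \<gamma>: "surface_curve X f (\<phi> u) ?V ?\<gamma>" by (rule surface_curve_coordinate[OF \<phi> u])
  have "smooth_on U (g \<circ> \<phi>)" "smooth_on U' (g \<circ> \<phi>')" using g \<phi> \<phi>' by (auto simp: smooth_map_def)
  then have "((\<lambda>t. g (?\<gamma> t)) has_vector_derivative frechet_derivative (g \<circ> \<phi>) (at u) w) (at 0)"
      "((\<lambda>t. g (?\<gamma> t)) has_vector_derivative Z) (at 0)"
    using coordinate_derivative_of_surface_curve[OF \<phi> u _ \<gamma>]
      coordinate_derivative_of_surface_curve[OF \<phi>' u', of g w' ?\<gamma>] \<gamma> eq V Z by simp_all
  then show "Z = frechet_derivative (g \<circ> \<phi>) (at u) w" by (rule vector_derivative_unique_at[symmetric])
qed

lemma surface_diff_has_surface_derivative: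
  assumes X: "immersed_surface X f" and p: "p \<in> topspace X" and g: "smooth_map X f g"
  shows "\<exists>L. has_surface_derivative X f g p L \<and> (\<forall>V\<in>tangent_plane X f p. surface_diff X f g p V = L V)"
proof -
  obtain U \<phi> u where \<phi>: "local_param X f U \<phi>" and u: "u \<in> U" and p_eq: "p = \<phi> u"
    using X p by (auto simp: immersed_surface_def)
  let ?D = "frechet_derivative (f \<circ> \<phi>) (at u)" and ?E = "frechet_derivative (g \<circ> \<phi>) (at u)"
  have sf: "smooth_on U (f \<circ> \<phi>)" and inj: "inj ?D" using \<phi> u by (auto simp: local_param_def)
  have sg: "smooth_on U (g \<circ> \<phi>)" using g \<phi> by (auto simp: smooth_map_def)
  have lin: "linear ?D" "linear ?E"
    using smooth_on_has_derivative[OF sf u] smooth_on_has_derivative[OF sg u] has_derivative_linear by blast+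
  obtain G where G: "linear G" "G \<circ> ?D = id" using linear_injective_left_inverse[OF lin(1) inj] by blast
  then have GD: "G (?D w) = w" for w by (simp add: fun_eq_iff)
  have "has_surface_derivative X f g p (?E \<circ> G)"
    unfolding has_surface_derivative_def
  proof (intro conjI allI impI)
    show "linear (?E \<circ> G)" by (rule linear_compose[OF G(1) lin(2)])
    fix \<gamma> V assume \<gamma>: "surface_curve X f p V \<gamma>"
    then obtain w where w: "V = ?D w" using surface_curve_pull_back[OF \<phi> u, of V \<gamma>] p_eq by blast
    show "((\<lambda>t. g (\<gamma> t)) has_vector_derivative (?E \<circ> G) V) (at 0)"
      using coordinate_derivative_of_surface_curve[OF \<phi> u sg, of w \<gamma>] \<gamma> by (simp add: p_eq w GD)
  qed
  moreover have "\<forall>V\<in>tangent_plane X f p. surface_diff X f g p V = (?E \<circ> G) V"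
    using surface_diff_coordinate[OF \<phi> u g] by (auto simp: p_eq tangent_plane_eq_range[OF \<phi> u] GD)
  ultimately show ?thesis by blast
qed

lemma surface_curve_tangent:
  assumes X: "immersed_surface X f" and \<gamma>: "surface_curve X f p V \<gamma>"
  shows "V \<in> tangent_plane X f p"
proof -
  have "p \<in> topspace X" using \<gamma> by (auto simp: surface_curve_def limitin_def)
  then obtain U \<phi> u where \<phi>: "local_param X f U \<phi>" "u \<in> U" "p = \<phi> u"
    using X by (auto simp: immersed_surface_def)
  then show ?thesis
    using surface_curve_pull_back[OF \<phi>(1,2), of V \<gamma>] \<gamma> tangent_plane_eq_range[OF \<phi>(1,2)] by auto
qed

lemma surface_curve_exists:
  assumes "V \<in> tangent_plane X f p"
  obtains \<gamma> where "surface_curve X f p V \<gamma>"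
proof -
  obtain U \<phi> u w where "local_param X f U \<phi>" "u \<in> U" "\<phi> u = p" "V = frechet_derivative (f \<circ> \<phi>) (at u) w"
    using assms by (auto simp: tangent_plane_def)
  then show ?thesis using surface_curve_coordinate that by metis
qed

text \<open>With \<open>g = h\<close> this says that differentials are unique on the tangent plane.\<close>

lemma has_surface_derivative_cong:
  assumes L: "has_surface_derivative X f g p L" and M: "has_surface_derivative X f h p M"
    and eq: "\<And>x. x \<in> topspace X \<Longrightarrow> g x = h x" and V: "V \<in> tangent_plane X f p"
  shows "L V = M V"
proof -
  obtain \<gamma> where \<gamma>: "surface_curve X f p V \<gamma>" using surface_curve_exists[OF V] .
  have p: "p \<in> topspace X" "\<gamma> 0 = p" using \<gamma> by (auto simp: surface_curve_def limitin_def)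
  have "\<forall>\<^sub>F t in at 0. g (\<gamma> t) = h (\<gamma> t)" using eventually_surface_curve[OF \<gamma>] by eventually_elim (rule eq)
  then have "((\<lambda>t. h (\<gamma> t)) has_vector_derivative L V) (at 0)"
    by (rule has_vector_derivative_transform_eventually[OF has_surface_derivativeD[OF L \<gamma>]]) (use p eq in simp)
  then show ?thesis
    using has_surface_derivativeD[OF M \<gamma>] vector_derivative_unique_at by blast
qed

text \<open>A linear extension of \<open>surface_diff X f g p\<close> from the tangent plane to the whole space.\<close>

definition surface_derivative ::
    "'a topology \<Rightarrow> ('a \<Rightarrow> real^3) \<Rightarrow> ('a \<Rightarrow> real^3) \<Rightarrow> 'a \<Rightarrow> real^3 \<Rightarrow> real^3" where
  "surface_derivative X f g p = (SOME L. has_surface_derivative X f g p L)"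

lemma
  assumes X: "immersed_surface X f" and p: "p \<in> topspace X" and g: "smooth_map X f g"
  shows surface_derivative: "has_surface_derivative X f g p (surface_derivative X f g p)"
    and surface_diff_eq_surface_derivative:
      "V \<in> tangent_plane X f p \<Longrightarrow> surface_diff X f g p V = surface_derivative X f g p V"
proof -
  obtain L where L: "has_surface_derivative X f g p L"
    and diff: "\<forall>V\<in>tangent_plane X f p. surface_diff X f g p V = L V"
    using surface_diff_has_surface_derivative[OF assms] by blast
  show *: "has_surface_derivative X f g p (surface_derivative X f g p)"
    unfolding surface_derivative_def by (rule someI[of "has_surface_derivative X f g p", OF L])
  show "surface_diff X f g p V = surface_derivative X f g p V" if V: "V \<in> tangent_plane X f p"
    using diff V has_surface_derivative_cong[OF L * refl V] by simp
qed

lemma tangent_plane_subspace: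
  assumes X: "immersed_surface X f" and p: "p \<in> topspace X"
  shows "subspace (tangent_plane X f p)" and "dim (tangent_plane X f p) = 2"
proof -
  obtain U \<phi> u where \<phi>: "local_param X f U \<phi>" and u: "u \<in> U" and p_eq: "p = \<phi> u"
    using X p by (auto simp: immersed_surface_def)
  let ?D = "frechet_derivative (f \<circ> \<phi>) (at u)"
  have sf: "smooth_on U (f \<circ> \<phi>)" and inj: "inj ?D" using \<phi> u by (auto simp: local_param_def)
  have lin: "linear ?D" using smooth_on_has_derivative[OF sf u] has_derivative_linear by blast
  show "subspace (tangent_plane X f p)"
    unfolding p_eq tangent_plane_eq_range[OF \<phi> u] using lin by (rule linear_subspace_image) simp
  show "dim (tangent_plane X f p) = 2"
    unfolding p_eq tangent_plane_eq_range[OF \<phi> u] using dim_image_eq[OF lin, of UNIV] inj by simp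
qed

lemma continuous_map_smooth:
  assumes X: "immersed_surface X f" and g: "smooth_map X f g"
  shows "continuous_map X euclidean g"
  unfolding continuous_map_def
proof (intro conjI allI impI)
  fix W :: "(real^3) set" assume "openin euclidean W"
  then have W: "open W" by simp
  show "openin X {x \<in> topspace X. g x \<in> W}"
  proof (subst openin_subopen, intro ballI)
    fix p assume "p \<in> {x \<in> topspace X. g x \<in> W}"
    then obtain U \<phi> u where \<phi>: "local_param X f U \<phi>" and u: "u \<in> U" and p_eq: "p = \<phi> u" and gW: "g (\<phi> u) \<in> W"
      using X by (auto simp: immersed_surface_def)
    have U: "open U" and op: "openin X (\<phi> ` U)" and hom: "homeomorphic_map (top_of_set U) (subtopology X (\<phi> ` U)) \<phi>"
      using \<phi> by (auto simp: local_param_def)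
    have "smooth_on U (g \<circ> \<phi>)" using g \<phi> by (auto simp: smooth_map_def)
    then have "continuous_on U (g \<circ> \<phi>)" by (metis smooth_on_def Ck_on.simps(1))
    then have "openin (top_of_set U) (U \<inter> (g \<circ> \<phi>) -` W)" using W by (rule continuous_openin_preimage_gen)
    then have "openin (subtopology X (\<phi> ` U)) (\<phi> ` (U \<inter> (g \<circ> \<phi>) -` W))"
      using homeomorphic_imp_open_map[OF hom] by (simp add: open_map_def)
    then have "openin X (\<phi> ` (U \<inter> (g \<circ> \<phi>) -` W))" using op by (rule openin_trans_full)
    moreover have "p \<in> \<phi> ` (U \<inter> (g \<circ> \<phi>) -` W)" using u gW p_eq by auto
    moreover have "\<phi> ` (U \<inter> (g \<circ> \<phi>) -` W) \<subseteq> {x \<in> topspace X. g x \<in> W}"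
      using openin_subset[OF op] by auto
    ultimately show "\<exists>T. openin X T \<and> p \<in> T \<and> T \<subseteq> {x \<in> topspace X. g x \<in> W}" by blast
  qed
qed simp

lemma smooth_map_self: "smooth_map X f f"
  by (auto simp: smooth_map_def local_param_def)

lemma surface_curve_image:
  assumes B: "has_surface_derivative X f g p B" and g: "\<And>x. x \<in> topspace X \<Longrightarrow> g x \<in> S"
    and \<gamma>: "surface_curve X f p V \<gamma>"
  shows "surface_curve (top_of_set S) id (g p) (B V) (\<lambda>t. g (\<gamma> t))"
proof -
  have d: "((\<lambda>t. g (\<gamma> t)) has_vector_derivative B V) (at 0)" by (rule has_surface_derivativeD[OF B \<gamma>])
  have p: "p \<in> topspace X" and \<gamma>0: "\<gamma> 0 = p" using \<gamma> by (auto simp: surface_curve_def limitin_def)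
  have "\<forall>\<^sub>F t in at 0. g (\<gamma> t) \<in> S" using eventually_surface_curve[OF \<gamma>] by eventually_elim (rule g)
  then show ?thesis
    using has_vector_derivative_imp_tendsto[OF d] d g[OF p] \<gamma>0 by (simp add: surface_curve_def limitin_subtopology)
qed

lemma has_surface_derivative_compose:
  assumes B: "has_surface_derivative X f g p B" and A: "has_surface_derivative (top_of_set S) id h (g p) A"
    and g: "\<And>x. x \<in> topspace X \<Longrightarrow> g x \<in> S"
  shows "has_surface_derivative X f (\<lambda>x. h (g x)) p (\<lambda>V. A (B V))"
proof -
  have "linear (A \<circ> B)" using A B linear_compose by (auto simp: has_surface_derivative_def)
  then show ?thesis
    using has_surface_derivativeD[OF A surface_curve_image[OF B g]] by (simp add: has_surface_derivative_def o_def)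
qed

text \<open>A continuous injection of a compact space into a Hausdorff space is an embedding, so convergence
  can be tested on the images.\<close>

lemma limitin_of_injective_compact:
  fixes f :: "'a \<Rightarrow> 'b::t2_space"
  assumes X: "compact_space X" and f: "continuous_map X euclidean f" and inj: "inj_on f (topspace X)"
    and q: "q \<in> topspace X" and \<sigma>: "\<forall>\<^sub>F t in F. \<sigma> t \<in> topspace X" and lim: "((\<lambda>t. f (\<sigma> t)) \<longlongrightarrow> f q) F"
  shows "limitin X \<sigma> q F"
  unfolding limitin_def
proof (intro conjI allI impI)
  fix U assume U: "openin X U \<and> q \<in> U"
  have "closedin X (topspace X - U)" using U by blast
  then have "compactin X (topspace X - U)" using X by (simp add: closedin_compact_space)
  then have "compact (f ` (topspace X - U))" using image_compactin[OF _ f] by simp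
  then have "open (- (f ` (topspace X - U)))" by (simp add: compact_imp_closed open_Compl)
  moreover have "f q \<in> - (f ` (topspace X - U))"
    using U q inj by (auto dest: inj_onD)
  ultimately have "\<forall>\<^sub>F t in F. f (\<sigma> t) \<in> - (f ` (topspace X - U))"
    using lim by (auto dest: topological_tendstoD)
  with \<sigma> show "\<forall>\<^sub>F t in F. \<sigma> t \<in> U" by eventually_elim auto
qed (rule q)

section \<open>Convex immersed surfaces and their normal fields\<close>

text \<open>Differentiate the identity \<open>n \<bullet> D\<^sub>w(f \<circ> \<phi>) = 0\<close> in the direction \<open>v\<close>.\<close>

lemma derivative_of_normal_in_coordinates:
  assumes \<phi>: "local_param X f U \<phi>" and u: "u \<in> U"
    and normal: "\<And>x V. x \<in> U \<Longrightarrow> V \<in> tangent_plane X f (\<phi> x) \<Longrightarrow> n (\<phi> x) \<bullet> V = 0"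
    and L: "has_surface_derivative X f n (\<phi> u) L"
    and E: "((\<lambda>x. frechet_derivative (f \<circ> \<phi>) (at x) w) has_derivative E) (at u)"
  shows "L (frechet_derivative (f \<circ> \<phi>) (at u) v) \<bullet> frechet_derivative (f \<circ> \<phi>) (at u) w = - (n (\<phi> u) \<bullet> E v)"
proof -
  let ?D = "\<lambda>x. frechet_derivative (f \<circ> \<phi>) (at x)" and ?c = "\<lambda>t. u + t *\<^sub>R v"
  have c: "(?c has_vector_derivative v) (at 0)" by (auto intro!: derivative_eq_intros)
  have "open U" using \<phi> by (simp add: local_param_def)
  have "(?c \<longlongrightarrow> u) (at 0)" by (auto intro!: tendsto_eq_intros)
  then have ev: "\<forall>\<^sub>F t in at 0. ?c t \<in> U" using \<open>open U\<close> u by (rule topological_tendstoD)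
  have "((\<lambda>t. n (\<phi> (?c t))) has_vector_derivative L (?D u v)) (at 0)"
    by (rule has_surface_derivativeD[OF L surface_curve_coordinate[OF \<phi> u]])
  moreover have "((\<lambda>t. ?D (?c t) w) has_vector_derivative E v) (at 0)"
    by (rule has_vector_derivative_compose[OF c, where F = "\<lambda>x. ?D x w"]) (use E in simp)
  ultimately have "((\<lambda>t. n (\<phi> (?c t)) \<bullet> ?D (?c t) w) has_vector_derivative
      n (\<phi> (?c 0)) \<bullet> E v + L (?D u v) \<bullet> ?D (?c 0) w) (at 0)"
    by (rule bounded_bilinear.has_vector_derivative[OF bounded_bilinear_inner])
  moreover have zero: "n (\<phi> x) \<bullet> ?D x w = 0" if "x \<in> U" for x
    using normal[OF that] tangent_plane_eq_range[OF \<phi> that] by auto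
  have "\<forall>\<^sub>F t in at 0. n (\<phi> (?c t)) \<bullet> ?D (?c t) w = 0" using ev by eventually_elim (rule zero)
  ultimately have "((\<lambda>t. 0) has_vector_derivative n (\<phi> (?c 0)) \<bullet> E v + L (?D u v) \<bullet> ?D (?c 0) w) (at 0)"
    by (rule has_vector_derivative_transform_eventually) (use zero[OF u] in simp)
  then have "n (\<phi> u) \<bullet> E v + L (?D u v) \<bullet> ?D u w = 0"
    using vector_derivative_unique_at[OF _ has_vector_derivative_const] by fastforce
  then show ?thesis by simp
qed

text \<open>A linear functional has derivative zero along all curves through a point where it attains its
  maximum over the surface.\<close>

lemma tangent_plane_of_extremum:
  assumes max: "\<And>q. q \<in> topspace X \<Longrightarrow> m \<bullet> f q \<le> m \<bullet> f p"
    and V: "V \<in> tangent_plane X f p"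
  shows "m \<bullet> V = 0"
proof -
  obtain \<gamma> where \<gamma>: "surface_curve X f p V \<gamma>" using surface_curve_exists[OF V] .
  then have \<gamma>0: "\<gamma> 0 = p" and d: "((\<lambda>t. f (\<gamma> t)) has_vector_derivative V) (at 0)"
    by (auto simp: surface_curve_def)
  have "((\<lambda>t. m \<bullet> f (\<gamma> t)) has_vector_derivative m \<bullet> V) (at 0)"
    by (rule bounded_linear.has_vector_derivative[OF bounded_linear_inner_right d])
  then have D: "((\<lambda>t. m \<bullet> f (\<gamma> t)) has_real_derivative m \<bullet> V) (at 0)"
    by (simp add: has_real_derivative_iff_has_vector_derivative)
  have "\<forall>\<^sub>F t in at 0. m \<bullet> f (\<gamma> t) \<le> m \<bullet> f (\<gamma> 0)"
    using eventually_surface_curve[OF \<gamma>] unfolding \<gamma>0 by eventually_elim (rule max)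
  then obtain d where "d > 0" and d: "\<And>t. t \<noteq> 0 \<Longrightarrow> \<bar>t\<bar> < d \<Longrightarrow> m \<bullet> f (\<gamma> t) \<le> m \<bullet> f (\<gamma> 0)"
    unfolding eventually_at by (auto simp: dist_norm)
  show ?thesis
  proof (rule DERIV_local_max[OF D \<open>d > 0\<close>], intro allI impI)
    fix t :: real assume "\<bar>0 - t\<bar> < d"
    then show "m \<bullet> f (\<gamma> t) \<le> m \<bullet> f (\<gamma> 0)" using d[of t] by (cases "t = 0") simp_all
  qed
qed

lemma tangent_plane_eq_orthogonal_complement:
  assumes "immersed_surface X f" and "p \<in> topspace X" and "m \<noteq> 0"
    and "\<And>V. V \<in> tangent_plane X f p \<Longrightarrow> m \<bullet> V = 0"
  shows "tangent_plane X f p = {V. m \<bullet> V = 0}"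
proof (rule subspace_dim_equal)
  show "dim {V. m \<bullet> V = 0} \<le> dim (tangent_plane X f p)"
    using dim_hyperplane[OF \<open>m \<noteq> 0\<close>] tangent_plane_subspace(2)[OF assms(1,2)] by simp
qed (use assms tangent_plane_subspace(1)[OF assms(1,2)] in \<open>auto simp: subspace_hyperplane\<close>)

text \<open>The vector \<open>\<xi>\<close> that witnesses \<open>outward\<close> is orthogonal to the tangent plane and hence a multiple of
  \<open>m\<close>; the test vector \<open>v\<close> shows that the factor is positive.\<close>

lemma supporting_of_outward:
  assumes X: "immersed_surface X f" and p: "p \<in> topspace X" and m: "norm m = 1"
    and normal: "\<And>V. V \<in> tangent_plane X f p \<Longrightarrow> m \<bullet> V = 0"
    and v: "outward X f p v" "0 < m \<bullet> v" and q: "q \<in> topspace X"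
  shows "m \<bullet> f q \<le> m \<bullet> f p"
proof -
  obtain \<xi> where \<xi>: "\<And>V. V \<in> tangent_plane X f p \<Longrightarrow> \<xi> \<bullet> V = 0"
    and supp: "\<xi> \<bullet> (f q - f p) \<le> 0" and pos: "0 < \<xi> \<bullet> v"
    using v(1) q unfolding outward_def by blast
  have "m \<noteq> 0" using m by auto
  have "tangent_plane X f p = {V. m \<bullet> V = 0}"
    by (rule tangent_plane_eq_orthogonal_complement[OF X p \<open>m \<noteq> 0\<close> normal])
  then have "\<xi> \<bullet> V = 0" if "m \<bullet> V = 0" for V using \<xi> that by simp
  then obtain a where a: "\<xi> = a *\<^sub>R m"
    using orthogonal_to_hyperplane_imp_multiple[OF m] by blast
  have "0 < a" using pos v(2) by (simp add: a zero_less_mult_iff)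
  then show ?thesis using supp by (simp add: a inner_diff_right mult_le_0_iff)
qed

text \<open>A convex surface with its outward unit normal field. The two instances are the unit sphere of the
  norm with \<open>\<nu>\<close>, and the surface of constant width with \<open>\<nu> \<circ> \<eta>\<close>. The last condition excludes
  surfaces that lie in a plane, for which both unit normals would be supporting.\<close>

locale convex_immersion =
  fixes X :: "'a topology" and f :: "'a \<Rightarrow> real^3" and n :: "'a \<Rightarrow> real^3"
  assumes immersed: "immersed_surface X f"
    and unit: "p \<in> topspace X \<Longrightarrow> norm (n p) = 1"
    and normal: "p \<in> topspace X \<Longrightarrow> V \<in> tangent_plane X f p \<Longrightarrow> n p \<bullet> V = 0"
    and supporting: "p \<in> topspace X \<Longrightarrow> q \<in> topspace X \<Longrightarrow> n p \<bullet> f q \<le> n p \<bullet> f p"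
    and not_flat: "p \<in> topspace X \<Longrightarrow> \<exists>q\<in>topspace X. n p \<bullet> f q \<noteq> n p \<bullet> f p"

context convex_immersion
begin

lemma tangent_plane_eq:
  assumes p: "p \<in> topspace X"
  shows "tangent_plane X f p = {V. n p \<bullet> V = 0}"
proof (rule tangent_plane_eq_orthogonal_complement[OF immersed p])
  show "n p \<noteq> 0" using unit[OF p] by auto
qed (rule normal[OF p])

lemma normal_unique:
  assumes p: "p \<in> topspace X" and m: "norm m = 1" and max: "\<And>q. q \<in> topspace X \<Longrightarrow> m \<bullet> f q \<le> m \<bullet> f p"
  shows "m = n p"
proof -
  have perp: "m \<bullet> V = 0" if "n p \<bullet> V = 0" for V
    by (rule tangent_plane_of_extremum[where X = X and f = f and p = p])
      (use max that in \<open>auto simp: tangent_plane_eq[OF p]\<close>)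
  obtain a where eq: "m = a *\<^sub>R n p"
    using orthogonal_to_hyperplane_imp_multiple[OF unit[OF p] perp] ..
  have "\<bar>a\<bar> = 1" using m unit[OF p] by (simp add: eq)
  moreover have "a \<noteq> -1"
  proof
    assume "a = -1"
    moreover obtain q where "q \<in> topspace X" "n p \<bullet> f q \<noteq> n p \<bullet> f p" using not_flat[OF p] by blast
    ultimately show False using max[of q] supporting[OF p, of q] by (simp add: eq)
  qed
  ultimately have "a = 1" by linarith
  then show ?thesis by (simp add: eq)
qed

context
  fixes p L
  assumes p: "p \<in> topspace X" and L: "has_surface_derivative X f n p L"
begin

text \<open>Differentiate \<open>n \<bullet> n = 1\<close>.\<close>

lemma derivative_tangent:
  assumes V: "V \<in> tangent_plane X f p"
  shows "L V \<in> tangent_plane X f p"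
proof -
  obtain \<gamma> where \<gamma>: "surface_curve X f p V \<gamma>" using surface_curve_exists[OF V] .
  then have \<gamma>0: "\<gamma> 0 = p" by (simp add: surface_curve_def)
  have d: "((\<lambda>t. n (\<gamma> t)) has_vector_derivative L V) (at 0)" by (rule has_surface_derivativeD[OF L \<gamma>])
  have "((\<lambda>t. n (\<gamma> t) \<bullet> n (\<gamma> t)) has_vector_derivative n (\<gamma> 0) \<bullet> L V + L V \<bullet> n (\<gamma> 0)) (at 0)"
    by (rule bounded_bilinear.has_vector_derivative[OF bounded_bilinear_inner d d])
  moreover have one: "n x \<bullet> n x = 1" if "x \<in> topspace X" for x using unit[OF that] by (simp add: norm_eq_1)
  have "\<forall>\<^sub>F t in at 0. n (\<gamma> t) \<bullet> n (\<gamma> t) = 1"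
    using eventually_surface_curve[OF \<gamma>] by eventually_elim (rule one)
  ultimately have "((\<lambda>t. 1) has_vector_derivative n (\<gamma> 0) \<bullet> L V + L V \<bullet> n (\<gamma> 0)) (at 0)"
    by (rule has_vector_derivative_transform_eventually) (use one p \<gamma>0 in simp)
  then have "n (\<gamma> 0) \<bullet> L V + L V \<bullet> n (\<gamma> 0) = 0"
    by (rule vector_derivative_unique_at) (rule has_vector_derivative_const)
  then show ?thesis by (simp add: tangent_plane_eq[OF p] \<gamma>0 inner_commute)
qed

text \<open>In a chart, both sides are second derivatives of \<open>n p \<bullet> (f \<circ> \<phi>)\<close>, up to sign.\<close>

lemma derivative_self_adjoint:
  assumes V: "V \<in> tangent_plane X f p" and W: "W \<in> tangent_plane X f p"
  shows "L V \<bullet> W = L W \<bullet> V"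
proof -
  obtain U \<phi> u where \<phi>: "local_param X f U \<phi>" and u: "u \<in> U" and p_eq: "p = \<phi> u"
    using immersed p by (auto simp: immersed_surface_def)
  let ?D = "\<lambda>x. frechet_derivative (f \<circ> \<phi>) (at x)"
  obtain v w where vw: "V = ?D u v" "W = ?D u w"
    using V W by (auto simp: p_eq tangent_plane_eq_range[OF \<phi> u])
  have U: "open U" and sm: "smooth_on U (f \<circ> \<phi>)" and op: "openin X (\<phi> ` U)"
    using \<phi> by (auto simp: local_param_def)
  have normal': "n (\<phi> x) \<bullet> V = 0" if "x \<in> U" "V \<in> tangent_plane X f (\<phi> x)" for x V
    using normal openin_subset[OF op] that by blast
  have E: "((\<lambda>x. ?D x w) has_derivative frechet_derivative (\<lambda>x. ?D x w) (at u)) (at u)" for w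
    by (rule smooth_on_has_derivative[OF smooth_on_frechet_derivative[OF sm] u])
  have dm: "((\<lambda>x. n p \<bullet> (f \<circ> \<phi>) x) has_derivative (\<lambda>h. n p \<bullet> ?D x h)) (at x)" if "x \<in> U" for x
    using smooth_on_has_derivative[OF sm that] by (rule has_derivative_inner_right)
  have "n p \<bullet> frechet_derivative (\<lambda>x. ?D x v) (at u) w = n p \<bullet> frechet_derivative (\<lambda>x. ?D x w) (at u) v"
    using U u dm has_derivative_inner_right[OF E] has_derivative_inner_right[OF E]
    by (rule second_derivative_symmetric)
  then show ?thesis
    using derivative_of_normal_in_coordinates[OF \<phi> u normal' L[unfolded p_eq] E] by (simp add: vw p_eq)
qed

text \<open>Normals of a convex surface are monotone: \<open>(n x - n y) \<bullet> (f x - f y) \<ge> 0\<close>, as each of the two points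
  lies on the inner side of the supporting plane at the other. Divide by \<open>t\<^sup>2\<close> along a curve.\<close>

lemma derivative_nonneg:
  assumes V: "V \<in> tangent_plane X f p"
  shows "0 \<le> L V \<bullet> V"
proof -
  obtain \<gamma> where \<gamma>: "surface_curve X f p V \<gamma>" using surface_curve_exists[OF V] .
  then have \<gamma>0: "\<gamma> 0 = p" and d: "((\<lambda>t. f (\<gamma> t)) has_vector_derivative V) (at 0)"
    by (auto simp: surface_curve_def)
  have "((\<lambda>t. (1/t) *\<^sub>R (n (\<gamma> t) - n p)) \<longlongrightarrow> L V) (at 0)" "((\<lambda>t. (1/t) *\<^sub>R (f (\<gamma> t) - f p)) \<longlongrightarrow> V) (at 0)"
    using has_vector_derivative_imp_quotient[OF has_surface_derivativeD[OF L \<gamma>]]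
      has_vector_derivative_imp_quotient[OF d] by (simp_all add: \<gamma>0)
  then have "((\<lambda>t. ((1/t) *\<^sub>R (n (\<gamma> t) - n p)) \<bullet> ((1/t) *\<^sub>R (f (\<gamma> t) - f p))) \<longlongrightarrow> L V \<bullet> V) (at 0)"
    by (rule tendsto_inner)
  moreover have "\<forall>\<^sub>F t in at 0. 0 \<le> ((1/t) *\<^sub>R (n (\<gamma> t) - n p)) \<bullet> ((1/t) *\<^sub>R (f (\<gamma> t) - f p))"
    using eventually_surface_curve[OF \<gamma>]
  proof eventually_elim
    case (elim t)
    have "(n (\<gamma> t) - n p) \<bullet> (f (\<gamma> t) - f p) \<ge> 0"
      using supporting[OF elim p] supporting[OF p elim] by (simp add: inner_diff_left inner_diff_right)
    then show ?case by simp
  qed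
  ultimately show ?thesis by (rule tendsto_lowerbound) simp
qed

text \<open>If \<open>V\<close> were a null vector of the semidefinite form, \<open>L V\<close> would be orthogonal to all tangent
  vectors, in particular to itself.\<close>

lemma derivative_positive:
  assumes V: "V \<in> tangent_plane X f p" "V \<noteq> 0"
    and inj: "\<And>W. W \<in> tangent_plane X f p \<Longrightarrow> L W = 0 \<Longrightarrow> W = 0"
  shows "0 < L V \<bullet> V"
proof (rule ccontr)
  assume "\<not> 0 < L V \<bullet> V"
  then have 0: "L V \<bullet> V = 0" using derivative_nonneg[OF V(1)] by simp
  let ?W = "L V"
  have W: "?W \<in> tangent_plane X f p" by (rule derivative_tangent[OF V(1)])
  have sub: "subspace (tangent_plane X f p)" by (rule tangent_plane_subspace(1)[OF immersed p])
  have lin: "linear L" using L by (simp add: has_surface_derivative_def)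
  have "L V \<bullet> ?W = 0"
    by (rule nonneg_form_null_vector[OF sub lin derivative_self_adjoint derivative_nonneg V(1) 0 W])
  then show False using inj[OF V(1)] V(2) by simp
qed

end

end

section \<open>The unit ball of an admissible norm\<close>

locale minkowski_ball =
  fixes N :: "real^3 \<Rightarrow> real" and \<nu> :: "real^3 \<Rightarrow> real^3"
  assumes admissible: "admissible_norm N"
    and gauss: "euclidean_gauss_map (sphere_top N) id \<nu>"
begin

abbreviation S :: "(real^3) set" where "S \<equiv> unit_sphere N"

lemma norm_nonneg: "0 \<le> N x"
  and norm_eq_zero: "N x = 0 \<longleftrightarrow> x = 0"
  and norm_scale: "N (a *\<^sub>R x) = \<bar>a\<bar> * N x"
  and norm_triangle: "N (x + y) \<le> N x + N y"
  using admissible by (auto simp: admissible_norm_def is_norm_def)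

lemma norm_minus: "N (- x) = N x"
  using norm_scale[of "-1" x] by simp

lemma norm_pos: "x \<noteq> 0 \<Longrightarrow> 0 < N x"
  using norm_nonneg[of x] norm_eq_zero[of x] by linarith

lemma normalized_in_sphere: "x \<noteq> 0 \<Longrightarrow> (1 / N x) *\<^sub>R x \<in> S"
  using norm_pos[of x] by (simp add: unit_sphere_def norm_scale)

lemma minus_in_sphere: "x \<in> S \<Longrightarrow> - x \<in> S"
  by (simp add: unit_sphere_def norm_minus)

lemma immersed_sphere: "immersed_surface (sphere_top N) id"
  using admissible by (simp add: admissible_norm_def)

lemma gauss_map_convex_immersion:
  assumes \<nu>': "euclidean_gauss_map (sphere_top N) id \<nu>'"
  shows "convex_immersion (sphere_top N) id \<nu>'"
proof
  show "immersed_surface (sphere_top N) id" by (rule immersed_sphere)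
  fix x assume x: "x \<in> topspace (sphere_top N)"
  show unit: "norm (\<nu>' x) = 1" using \<nu>' x by (simp add: euclidean_gauss_map_def)
  show normal: "\<nu>' x \<bullet> V = 0" if "V \<in> tangent_plane (sphere_top N) id x" for V
    using \<nu>' x that by (simp add: euclidean_gauss_map_def)
  have "0 < \<nu>' x \<bullet> \<nu>' x" using unit by (simp add: norm_eq_1)
  then show supp: "\<nu>' x \<bullet> id y \<le> \<nu>' x \<bullet> id x" if "y \<in> topspace (sphere_top N)" for y
    using supporting_of_outward[OF immersed_sphere x unit normal _ _ that, of "\<nu>' x"] \<nu>' x
    by (simp add: euclidean_gauss_map_def)
  show "\<exists>y\<in>topspace (sphere_top N). \<nu>' x \<bullet> id y \<noteq> \<nu>' x \<bullet> id x"
  proof (rule ccontr)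
    assume "\<not> ?thesis"
    then have eq: "\<nu>' x \<bullet> y = \<nu>' x \<bullet> x" if "y \<in> S" for y using that by simp
    have nz: "\<nu>' x \<noteq> 0" using unit by auto
    have "x \<in> S" using x by simp
    then have 0: "\<nu>' x \<bullet> x = 0" using eq[OF minus_in_sphere] by force
    have "\<nu>' x \<bullet> ((1 / N (\<nu>' x)) *\<^sub>R \<nu>' x) = 0" using eq[OF normalized_in_sphere[OF nz]] 0 by simp
    then show False using nz norm_pos[OF nz] by simp
  qed
qed

end

sublocale minkowski_ball \<subseteq> ball: convex_immersion "sphere_top N" id \<nu>
  using gauss by (rule gauss_map_convex_immersion)

context minkowski_ball
begin

lemma sphere_supporting: "x \<in> S \<Longrightarrow> y \<in> S \<Longrightarrow> \<nu> x \<bullet> y \<le> \<nu> x \<bullet> x"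
  using ball.supporting by simp

lemma normal_inner_pos:
  assumes x: "x \<in> S"
  shows "0 < \<nu> x \<bullet> x"
proof (rule ccontr)
  assume "\<not> ?thesis"
  then have le: "\<nu> x \<bullet> x \<le> 0" by simp
  have 0: "\<nu> x \<bullet> y \<le> 0" if "y \<in> S" for y using sphere_supporting[OF x that] le by linarith
  have "\<nu> x \<bullet> y = 0" if "y \<in> S" for y using 0[OF that] 0[OF minus_in_sphere[OF that]] by simp
  then show False using ball.not_flat[of x] x by simp
qed

text \<open>The dual norm of \<open>\<nu> x\<close> is \<open>\<nu> x \<bullet> x\<close>.\<close>

lemma dual_norm_bound:
  assumes x: "x \<in> S"
  shows "\<nu> x \<bullet> z \<le> N z * (\<nu> x \<bullet> x)"
proof (cases "z = 0")
  case False
  then show ?thesis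
    using sphere_supporting[OF x normalized_in_sphere[OF False]] norm_pos[OF False] by (simp add: field_simps)
qed (use norm_eq_zero[of 0] in simp)

lemma gauss_map_unique:
  assumes x: "x \<in> S" and m: "norm m = 1" and max: "\<And>y. y \<in> S \<Longrightarrow> m \<bullet> y \<le> m \<bullet> x"
  shows "m = \<nu> x"
  using ball.normal_unique[of x m] assms by simp

lemma gauss_map_minus:
  assumes x: "x \<in> S"
  shows "\<nu> (- x) = - \<nu> x"
proof (rule gauss_map_unique[symmetric, OF minus_in_sphere[OF x]])
  show "norm (- \<nu> x) = 1" using ball.unit x by simp
  show "- \<nu> x \<bullet> y \<le> - \<nu> x \<bullet> - x" if "y \<in> S" for y
    using sphere_supporting[OF x minus_in_sphere[OF that]] by simp
qed

abbreviation d\<nu> :: "real^3 \<Rightarrow> real^3 \<Rightarrow> real^3" where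
  "d\<nu> \<equiv> surface_derivative (sphere_top N) id \<nu>"

lemma d\<nu>: "x \<in> S \<Longrightarrow> has_surface_derivative (sphere_top N) id \<nu> x (d\<nu> x)"
  using gauss by (intro surface_derivative[OF immersed_sphere]) (simp_all add: euclidean_gauss_map_def)

text \<open>Admissibility provides some Gauss map with non-degenerate differential. It agrees with \<open>\<nu>\<close> on the
  sphere because unit normals are determined by the supporting planes.\<close>

lemma gauss_map_derivative_injective:
  assumes x: "x \<in> S" and V: "V \<in> tangent_plane (sphere_top N) id x" "d\<nu> x V = 0"
  shows "V = 0"
proof -
  let ?T = "tangent_plane (sphere_top N) id x"
  have x': "x \<in> topspace (sphere_top N)" using x by simp
  obtain \<nu>' where \<nu>': "euclidean_gauss_map (sphere_top N) id \<nu>'"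
    and pos: "0 < plane_det ?T (surface_diff (sphere_top N) id \<nu>' x)"
    using admissible x by (auto simp: admissible_norm_def)
  have sm: "smooth_map (sphere_top N) id \<nu>'" using \<nu>' by (simp add: euclidean_gauss_map_def)
  interpret \<nu>': convex_immersion "sphere_top N" id \<nu>' by (rule gauss_map_convex_immersion[OF \<nu>'])
  have eq: "\<nu> y = \<nu>' y" if "y \<in> topspace (sphere_top N)" for y
    using gauss_map_unique[of y "\<nu>' y"] \<nu>'.unit[OF that] \<nu>'.supporting[OF that] that by simp
  show "V = 0"
  proof (rule plane_det_positive_imp_injective[where L = "d\<nu> x", OF _ _ _ _ _ pos V])
    show "subspace ?T" "dim ?T = 2" using tangent_plane_subspace[OF immersed_sphere x'] .
    show "linear (d\<nu> x)" using d\<nu>[OF x] by (simp add: has_surface_derivative_def)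
    show "d\<nu> x W \<in> ?T" if "W \<in> ?T" for W by (rule ball.derivative_tangent[OF x' d\<nu>[OF x] that])
    show "surface_diff (sphere_top N) id \<nu>' x W = d\<nu> x W" if "W \<in> ?T" for W
      using surface_diff_eq_surface_derivative[OF immersed_sphere x' sm that]
        has_surface_derivative_cong[OF d\<nu>[OF x] surface_derivative[OF immersed_sphere x' sm] eq that] by simp
  qed
qed

text \<open>Strict convexity of the unit ball. If \<open>\<nu> x = \<nu> y\<close>, the segment from \<open>x\<close> to \<open>y\<close> lies in the sphere and
  \<open>\<nu>\<close> is constant on it, so the differential of \<open>\<nu>\<close> at the midpoint maps the tangent vector \<open>y - x\<close> to
  zero.\<close>

lemma gauss_map_injective:
  assumes x: "x \<in> S" and y: "y \<in> S" and eq: "\<nu> x = \<nu> y"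
  shows "x = y"
proof -
  define \<gamma> where "\<gamma> t = x + (t + 1/2) *\<^sub>R (y - x)" for t :: real
  define z where "z = \<gamma> 0"
  have d: "(\<gamma> has_vector_derivative (y - x)) (at 0)"
    unfolding \<gamma>_def by (auto intro!: derivative_eq_intros)
  have pos: "0 < \<nu> x \<bullet> x" by (rule normal_inner_pos[OF x])
  have xy: "\<nu> x \<bullet> y = \<nu> x \<bullet> x" using sphere_supporting[OF x y] sphere_supporting[OF y x] eq by simp
  have h: "\<nu> x \<bullet> \<gamma> t = \<nu> x \<bullet> x" for t
    using xy by (simp add: \<gamma>_def inner_add_right inner_diff_right)
  have seg: "\<gamma> t \<in> S \<and> \<nu> (\<gamma> t) = \<nu> x" if t: "\<bar>t\<bar> < 1/2" for t
  proof -
    have "\<gamma> t = (1/2 - t) *\<^sub>R x + (1/2 + t) *\<^sub>R y"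
      by (simp add: \<gamma>_def vec_eq_iff) (simp add: field_simps)
    then have "N (\<gamma> t) \<le> \<bar>1/2 - t\<bar> * N x + \<bar>1/2 + t\<bar> * N y"
      using norm_triangle[of "(1/2 - t) *\<^sub>R x" "(1/2 + t) *\<^sub>R y"] by (simp add: norm_scale)
    then have "N (\<gamma> t) \<le> 1" using t x y by (simp add: unit_sphere_def)
    moreover have "1 \<le> N (\<gamma> t)" using dual_norm_bound[OF x, of "\<gamma> t"] h pos by simp
    ultimately have S: "\<gamma> t \<in> S" by (simp add: unit_sphere_def)
    have "\<nu> x = \<nu> (\<gamma> t)"
      by (rule gauss_map_unique[OF S]) (use ball.unit x sphere_supporting[OF x] h in auto)
    then show ?thesis using S by simp
  qed
  have ev: "\<forall>\<^sub>F t in at (0::real). \<bar>t\<bar> < 1/2"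
    unfolding eventually_at by (intro exI[of _ "1/2"]) (simp add: dist_norm)
  have z: "z \<in> S" using seg[of 0] by (simp add: z_def)
  have \<gamma>: "surface_curve (sphere_top N) id z (y - x) \<gamma>"
    using d has_vector_derivative_imp_tendsto[OF d] z ev seg
    by (auto simp: surface_curve_def limitin_subtopology z_def elim: eventually_mono)
  have "((\<lambda>t. \<nu> (\<gamma> t)) has_vector_derivative d\<nu> z (y - x)) (at 0)"
    by (rule has_surface_derivativeD[OF d\<nu>[OF z] \<gamma>])
  moreover have "\<forall>\<^sub>F t in at 0. \<nu> (\<gamma> t) = \<nu> x" using ev by eventually_elim (use seg in simp)
  ultimately have "((\<lambda>t. \<nu> x) has_vector_derivative d\<nu> z (y - x)) (at 0)"
    by (rule has_vector_derivative_transform_eventually) (use seg[of 0] in simp)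
  then have "d\<nu> z (y - x) = 0" by (rule vector_derivative_unique_at) (rule has_vector_derivative_const)
  then show ?thesis
    using gauss_map_derivative_injective[OF z surface_curve_tangent[OF immersed_sphere \<gamma>]] by simp
qed

lemma support_point_unique:
  assumes x: "x \<in> S" and z: "N z \<le> 1" "\<nu> x \<bullet> z = \<nu> x \<bullet> x"
  shows "z = x"
proof -
  have pos: "0 < \<nu> x \<bullet> x" by (rule normal_inner_pos[OF x])
  have "1 \<le> N z" using dual_norm_bound[OF x, of z] z(2) pos by simp
  then have S: "z \<in> S" using z(1) by (simp add: unit_sphere_def)
  have "\<nu> x = \<nu> z"
    by (rule gauss_map_unique[OF S]) (use ball.unit x sphere_supporting[OF x] z(2) in auto)
  then show ?thesis using gauss_map_injective[OF x S] by simp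
qed

lemma continuous_on_norm: "continuous_on A N"
proof -
  have "convex_on UNIV N"
  proof (rule convex_onI)
    fix t :: real and x y :: "real^3" assume "0 < t" "t < 1"
    then show "N ((1 - t) *\<^sub>R x + t *\<^sub>R y) \<le> (1 - t) * N x + t * N y"
      using norm_triangle[of "(1 - t) *\<^sub>R x" "t *\<^sub>R y"] by (simp add: norm_scale)
  qed simp
  then show ?thesis using convex_on_continuous[OF open_UNIV] continuous_on_subset by blast
qed

lemma continuous_on_gauss_map: "continuous_on S \<nu>"
  using continuous_map_smooth[OF immersed_sphere, of \<nu>] gauss
  by (simp add: euclidean_gauss_map_def)

text \<open>Let \<open>y t\<close> be the radial projection of \<open>x + t w\<close> to the sphere. As \<open>x + t w\<close> lies outside the open
  ball and \<open>x\<close> lies behind the supporting plane at \<open>y t\<close>, the numbers \<open>\<nu> (y t) \<bullet> w\<close> and \<open>t\<close> have the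
  same sign. Letting \<open>t\<close> tend to \<open>0\<close> from both sides gives \<open>\<nu> x \<bullet> w = 0\<close>.\<close>

lemma birkhoff_orthogonal_imp_tangent:
  assumes x: "x \<in> S" and orth: "birkhoff_orthogonal N x P" and w: "w \<in> P"
  shows "\<nu> x \<bullet> w = 0"
proof -
  define y where "y t = (1 / N (x + t *\<^sub>R w)) *\<^sub>R (x + t *\<^sub>R w)" for t
  have ge1: "1 \<le> N (x + t *\<^sub>R w)" for t
    using orth w x by (auto simp: birkhoff_orthogonal_def unit_sphere_def)
  have y: "y t \<in> S" for t
    unfolding y_def by (rule normalized_in_sphere) (use ge1[of t] norm_eq_zero[of "x + t *\<^sub>R w"] in auto)
  have sgn: "0 \<le> t * (\<nu> (y t) \<bullet> w)" for t
  proof -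
    let ?g = "N (x + t *\<^sub>R w)"
    have "x + t *\<^sub>R w = ?g *\<^sub>R y t" using ge1[of t] by (simp add: y_def)
    then have "\<nu> (y t) \<bullet> (x + t *\<^sub>R w) = ?g * (\<nu> (y t) \<bullet> y t)" by (metis inner_scaleR_right)
    then have "t * (\<nu> (y t) \<bullet> w) = ?g * (\<nu> (y t) \<bullet> y t) - \<nu> (y t) \<bullet> x" by (simp add: inner_add_right)
    moreover have "\<nu> (y t) \<bullet> x \<le> \<nu> (y t) \<bullet> y t" by (rule sphere_supporting[OF y x])
    moreover have "1 * (\<nu> (y t) \<bullet> y t) \<le> ?g * (\<nu> (y t) \<bullet> y t)"
      using ge1 normal_inner_pos[OF y] by (intro mult_right_mono) (auto intro: less_imp_le)
    ultimately show ?thesis by simp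
  qed
  have y0: "y 0 = x" using x by (simp add: y_def unit_sphere_def)
  have "isCont N z" for z using continuous_on_norm[of UNIV] by (simp add: continuous_on_eq_continuous_at)
  then have "((\<lambda>t. N (x + t *\<^sub>R w)) \<longlongrightarrow> N (x + 0 *\<^sub>R w)) (at 0)"
    by (rule isCont_tendsto_compose) (auto intro!: tendsto_eq_intros)
  then have "(y \<longlongrightarrow> (1 / N (x + 0 *\<^sub>R w)) *\<^sub>R (x + 0 *\<^sub>R w)) (at 0)"
    unfolding y_def using ge1[of 0] by (auto intro!: tendsto_eq_intros)
  then have "(y \<longlongrightarrow> x) (at 0)" using x by (simp add: unit_sphere_def)
  then have "((\<lambda>t. \<nu> (y t)) \<longlongrightarrow> \<nu> x) (at 0)"
    using continuous_on_tendsto_compose[OF continuous_on_gauss_map _ x always_eventually] y by blast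
  then have lim: "((\<lambda>t. \<nu> (y t) \<bullet> w) \<longlongrightarrow> \<nu> x \<bullet> w) (at 0)" by (intro tendsto_intros)
  have "0 \<le> \<nu> x \<bullet> w"
  proof (rule tendsto_lowerbound)
    show "((\<lambda>t. \<nu> (y t) \<bullet> w) \<longlongrightarrow> \<nu> x \<bullet> w) (at_right 0)" using lim by (simp add: filterlim_at_split)
    show "\<forall>\<^sub>F t in at_right 0. 0 \<le> \<nu> (y t) \<bullet> w"
      using eventually_at_right_less[of 0] by eventually_elim (use sgn in \<open>simp add: zero_le_mult_iff; force\<close>)
  qed simp
  moreover have "\<nu> x \<bullet> w \<le> 0"
  proof (rule tendsto_upperbound)
    show "((\<lambda>t. \<nu> (y t) \<bullet> w) \<longlongrightarrow> \<nu> x \<bullet> w) (at_left 0)" using lim by (simp add: filterlim_at_split)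
    show "\<forall>\<^sub>F t in at_left 0. \<nu> (y t) \<bullet> w \<le> 0"
    proof -
      have "\<forall>\<^sub>F t in at_left (0::real). t < 0" by (simp add: eventually_at_filter)
      then show ?thesis by eventually_elim (use sgn in \<open>simp add: zero_le_mult_iff; force\<close>)
    qed
  qed simp
  ultimately show ?thesis by simp
qed

lemma compact_unit_vectors:
  assumes T: "subspace T"
  shows "compact {V \<in> T. N V = 1}"
proof -
  have "compact (sphere (0::real^3) 1)" by simp
  moreover have "sphere (0::real^3) 1 \<noteq> {}" by simp
  ultimately obtain z where z: "z \<in> sphere 0 1" and min: "\<And>x. x \<in> sphere 0 1 \<Longrightarrow> N z \<le> N x"
    using continuous_attains_inf continuous_on_norm by metis
  have Nz: "0 < N z" using z by (intro norm_pos) auto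
  have "norm V \<le> 1 / N z" if "N V = 1" for V
  proof -
    have "V \<noteq> 0" using that norm_eq_zero[of 0] by auto
    then have "N z \<le> N ((1 / norm V) *\<^sub>R V)" by (intro min) simp
    also have "\<dots> = 1 / norm V" by (simp add: norm_scale that)
    finally show ?thesis using Nz \<open>V \<noteq> 0\<close> by (simp add: field_simps)
  qed
  then have "bounded {V \<in> T. N V = 1}" by (auto simp: bounded_iff)
  moreover have "closed (T \<inter> {V. N V = 1})"
    by (intro closed_Int closed_subspace[OF T] closed_Collect_eq continuous_on_norm continuous_on_const)
  ultimately show ?thesis by (simp add: compact_eq_bounded_closed Collect_conj_eq)
qed

text \<open>At an extremum \<open>V\<close> with value \<open>k V\<close>, the form \<open>k V * (A Z \<bullet> Z) - A (B Z) \<bullet> Z\<close> is semidefinite with null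
  vector \<open>V\<close>. Hence \<open>A (k V *\<^sub>R V - B V)\<close> is orthogonal to \<open>T\<close>, and \<open>B V = k V *\<^sub>R V\<close> since \<open>A\<close> is positive
  definite. The factor \<open>s\<close> serves to treat maxima (\<open>s = 1\<close>) and minima (\<open>s = - 1\<close>) together.\<close>

lemma rayleigh_quotient_extremum:
  assumes T: "subspace T" "T \<noteq> {0}" and A: "linear A" and B: "linear B" "\<And>V. V \<in> T \<Longrightarrow> B V \<in> T"
    and symA: "\<And>V W. V \<in> T \<Longrightarrow> W \<in> T \<Longrightarrow> A V \<bullet> W = A W \<bullet> V"
    and symAB: "\<And>V W. V \<in> T \<Longrightarrow> W \<in> T \<Longrightarrow> A (B V) \<bullet> W = A (B W) \<bullet> V"
    and pos: "\<And>V. V \<in> T \<Longrightarrow> V \<noteq> 0 \<Longrightarrow> 0 < A V \<bullet> V"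
    and "s \<noteq> 0"
  defines "k \<equiv> \<lambda>V. (A V \<bullet> B V) / (A V \<bullet> V)"
  shows "\<exists>V\<in>{V \<in> T. N V = 1}. (\<forall>Z\<in>{V \<in> T. N V = 1}. s * k Z \<le> s * k V) \<and> B V = k V *\<^sub>R V"
proof -
  let ?C = "{V \<in> T. N V = 1}"
  have C0: "V \<noteq> 0" if "V \<in> ?C" for V using that norm_eq_zero[of 0] by auto
  obtain V0 where V0: "V0 \<in> T" "V0 \<noteq> 0" using T subspace_0 by blast
  then have "(1 / N V0) *\<^sub>R V0 \<in> ?C"
    using normalized_in_sphere[OF V0(2)] T(1) by (simp add: unit_sphere_def subspace_scale)
  then have "?C \<noteq> {}" by blast
  moreover have "continuous_on ?C (\<lambda>V. s * k V)"
  proof -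
    have "A V \<bullet> V \<noteq> 0" if "V \<in> ?C" for V using pos[of V] C0[OF that] that by auto
    moreover have "continuous_on ?C A" "continuous_on ?C B"
      using A B(1) by (simp_all add: linear_continuous_on linear_conv_bounded_linear)
    ultimately show ?thesis unfolding k_def by (intro continuous_intros) auto
  qed
  ultimately have "\<exists>V\<in>?C. \<forall>Z\<in>?C. s * k Z \<le> s * k V"
    by (rule continuous_attains_sup[OF compact_unit_vectors[OF T(1)]])
  then obtain V where V: "V \<in> ?C" and max: "\<And>Z. Z \<in> ?C \<Longrightarrow> s * k Z \<le> s * k V" by blast
  have VT: "V \<in> T" and Vpos: "0 < A V \<bullet> V" using V pos[of V] C0[OF V] by auto
  define M where "M Z = s *\<^sub>R (k V *\<^sub>R A Z - A (B Z))" for Z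
  have M: "linear M"
    unfolding M_def using A linear_compose[OF B(1) A, unfolded o_def]
    by (intro linear_compose_scale_right linear_compose_sub)
  have AB: "A Z \<bullet> B Z = A (B Z) \<bullet> Z" if "Z \<in> T" for Z using symA[OF that B(2)[OF that]] .
  have M_nonneg: "0 \<le> M Z \<bullet> Z" if "Z \<in> T" for Z
  proof (cases "Z = 0")
    case False
    have p: "0 < A Z \<bullet> Z" by (rule pos[OF that False])
    have "(1 / N Z) *\<^sub>R Z \<in> ?C"
      using normalized_in_sphere[OF False] T(1) that by (simp add: unit_sphere_def subspace_scale)
    then have "s * k ((1 / N Z) *\<^sub>R Z) \<le> s * k V" by (rule max)
    moreover have "k ((1 / N Z) *\<^sub>R Z) = k Z"
      using norm_pos[OF False] by (simp add: k_def linear_cmul[OF A] linear_cmul[OF B(1)])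
    ultimately have "s * k Z * (A Z \<bullet> Z) \<le> s * k V * (A Z \<bullet> Z)" using p by (intro mult_right_mono) auto
    moreover have "k Z * (A Z \<bullet> Z) = A (B Z) \<bullet> Z" using p AB[OF that] by (simp add: k_def)
    ultimately show ?thesis by (simp add: M_def inner_diff_left algebra_simps)
  qed simp
  have MV0: "M V \<bullet> V = 0" using Vpos AB[OF VT] by (simp add: M_def inner_diff_left k_def)
  have null: "M V \<bullet> W = 0" if "W \<in> T" for W
  proof (rule nonneg_form_null_vector[OF T(1) M _ M_nonneg VT MV0 that])
    show "M Y \<bullet> Z = M Z \<bullet> Y" if "Y \<in> T" "Z \<in> T" for Y Z
      by (simp add: M_def inner_diff_left symA[OF that] symAB[OF that])
  qed
  let ?W = "k V *\<^sub>R V - B V"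
  have W: "?W \<in> T" using T(1) VT B(2) by (simp add: subspace_diff subspace_scale)
  have "s * (A ?W \<bullet> ?W) = M V \<bullet> ?W" by (simp add: M_def linear_diff[OF A] linear_cmul[OF A])
  then have "A ?W \<bullet> ?W = 0" using null[OF W] \<open>s \<noteq> 0\<close> by simp
  then have "?W = 0" using pos[OF W] by fastforce
  then show ?thesis using V max by auto
qed

end

section \<open>Surfaces of constant width\<close>

locale constant_width_surface = minkowski_ball N \<nu>
  for N \<nu> +
  fixes X :: "'a topology" and f :: "'a \<Rightarrow> real^3" and \<eta> :: "'a \<Rightarrow> real^3" and c :: real
  assumes immersed_surface: "immersed_surface X f"
    and compact: "compact_space X"
    and strictly_convex: "strictly_convex_surface X f"
    and birkhoff: "birkhoff_gauss_map N X f \<eta>"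
    and constant_width: "constant_minkowski_width N X f c"
    and curvature_pos: "p \<in> topspace X \<Longrightarrow> 0 < minkowski_gauss_curvature X f \<eta> p"
    and two_points: "\<exists>p\<in>topspace X. \<exists>q\<in>topspace X. p \<noteq> q"
begin

abbreviation n :: "'a \<Rightarrow> real^3" where "n p \<equiv> \<nu> (\<eta> p)"

lemma eta_in_sphere: "p \<in> topspace X \<Longrightarrow> \<eta> p \<in> S"
  using birkhoff by (simp add: birkhoff_gauss_map_def)

lemma normal_tangent: "p \<in> topspace X \<Longrightarrow> V \<in> tangent_plane X f p \<Longrightarrow> n p \<bullet> V = 0"
  using birkhoff birkhoff_orthogonal_imp_tangent[OF eta_in_sphere] by (auto simp: birkhoff_gauss_map_def)

lemma unit_normal: "p \<in> topspace X \<Longrightarrow> norm (n p) = 1"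
  using ball.unit eta_in_sphere by simp

lemma normal_supporting:
  assumes p: "p \<in> topspace X" and q: "q \<in> topspace X"
  shows "n p \<bullet> f q \<le> n p \<bullet> f p"
proof (rule supporting_of_outward[OF immersed_surface p unit_normal[OF p] normal_tangent[OF p] _ _ q])
  show "outward X f p (\<eta> p)" using birkhoff p by (simp add: birkhoff_gauss_map_def)
  show "0 < n p \<bullet> \<eta> p" by (rule normal_inner_pos[OF eta_in_sphere[OF p]])
qed

lemma normal_strictly_supporting:
  assumes p: "p \<in> topspace X" and q: "q \<in> topspace X" and "q \<noteq> p"
  shows "n p \<bullet> f q < n p \<bullet> f p"
proof -
  obtain \<xi> where \<xi>: "\<And>V. V \<in> tangent_plane X f p \<Longrightarrow> \<xi> \<bullet> V = 0" and neg: "\<xi> \<bullet> (f q - f p) < 0"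
    using strictly_convex p q \<open>q \<noteq> p\<close> unfolding strictly_convex_surface_def by blast
  have "n p \<noteq> 0" using unit_normal[OF p] by auto
  then have "tangent_plane X f p = {V. n p \<bullet> V = 0}"
    by (rule tangent_plane_eq_orthogonal_complement[OF immersed_surface p _ normal_tangent[OF p]])
  then have "\<xi> \<bullet> V = 0" if "n p \<bullet> V = 0" for V using \<xi> that by simp
  then obtain a where "\<xi> = a *\<^sub>R n p"
    using orthogonal_to_hyperplane_imp_multiple[OF unit_normal[OF p]] by blast
  then have "n p \<bullet> f q \<noteq> n p \<bullet> f p" using neg by (auto simp: inner_diff_right)
  then show ?thesis using normal_supporting[OF p q] by simp
qed

end

sublocale constant_width_surface \<subseteq> surf: convex_immersion X f n
proof
  show "\<exists>q\<in>topspace X. n p \<bullet> f q \<noteq> n p \<bullet> f p" if "p \<in> topspace X" for p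
    using two_points normal_strictly_supporting[OF that] by (metis less_irrefl)
qed (rule immersed_surface unit_normal normal_tangent normal_supporting; assumption)+

context constant_width_surface
begin

lemma injective: "inj_on f (topspace X)"
  using normal_strictly_supporting by (metis inj_onI less_irrefl)

lemma continuous_map_f: "continuous_map X euclidean f"
  by (rule continuous_map_smooth[OF immersed_surface smooth_map_self])

lemma maximum_attained: "\<exists>p\<in>topspace X. \<forall>q\<in>topspace X. m \<bullet> f q \<le> m \<bullet> f p"
proof -
  have "compactin X (topspace X)" using compact by (simp add: compact_space_def)
  then have "compact (f ` topspace X)" using image_compactin[OF _ continuous_map_f] by simp
  moreover have "f ` topspace X \<noteq> {}" using two_points by blast
  moreover have "continuous_on (f ` topspace X) ((\<bullet>) m)" by (intro continuous_intros)
  ultimately have "\<exists>x\<in>f ` topspace X. \<forall>y\<in>f ` topspace X. m \<bullet> y \<le> m \<bullet> x" by (rule continuous_attains_sup)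
  then show ?thesis by blast
qed

text \<open>The distance of the parallel planes \<open>\<nu> x \<bullet> y = a\<close> and \<open>\<nu> x \<bullet> y = b\<close> is \<open>\<bar>a - b\<bar>\<close> divided by the dual norm
  of \<open>\<nu> x\<close>, and it is attained along \<open>x\<close>. Constant width only speaks of two different planes; they
  are different because otherwise \<open>\<nu> x\<close> would be the normal at every point, contrary to strict
  convexity.\<close>

lemma width_in_direction:
  assumes x: "x \<in> S" and p: "p \<in> topspace X" "\<And>r. r \<in> topspace X \<Longrightarrow> \<nu> x \<bullet> f r \<le> \<nu> x \<bullet> f p"
    and q: "q \<in> topspace X" "\<And>r. r \<in> topspace X \<Longrightarrow> \<nu> x \<bullet> f q \<le> \<nu> x \<bullet> f r"
  shows "\<nu> x \<bullet> (f p - f q) = c * (\<nu> x \<bullet> x)" and "0 < \<nu> x \<bullet> (f p - f q)"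
proof -
  let ?\<xi> = "\<nu> x"
  let ?P = "{y. ?\<xi> \<bullet> y = ?\<xi> \<bullet> f p}" and ?Q = "{y. ?\<xi> \<bullet> y = ?\<xi> \<bullet> f q}"
  define d where "d = ?\<xi> \<bullet> (f p - f q)"
  have h: "0 < ?\<xi> \<bullet> x" by (rule normal_inner_pos[OF x])
  then have nz: "?\<xi> \<noteq> 0" by auto
  have unit: "norm ?\<xi> = 1" using ball.unit x by simp
  have "d \<noteq> 0"
  proof
    assume "d = 0"
    then have eq: "?\<xi> \<bullet> f r = ?\<xi> \<bullet> f p" if "r \<in> topspace X" for r
      using p(2)[OF that] q(2)[OF that] by (simp add: d_def inner_diff_right)
    obtain a b where ab: "a \<in> topspace X" "b \<in> topspace X" "b \<noteq> a" using two_points by metis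
    have "?\<xi> = n a" by (rule surf.normal_unique[OF ab(1) unit]) (simp add: eq ab(1))
    then show False using normal_strictly_supporting[OF ab] eq ab by simp
  qed
  moreover have "0 \<le> d" using p(2)[OF q(1)] by (simp add: d_def inner_diff_right)
  ultimately have d: "0 < d" by simp
  then show "0 < ?\<xi> \<bullet> (f p - f q)" by (simp add: d_def)
  have "supporting_plane X f ?P" unfolding supporting_plane_def using p nz by blast
  moreover have "supporting_plane X f ?Q"
    unfolding supporting_plane_def using q nz by (intro exI[of _ "- ?\<xi>"] exI[of _ q]) auto
  moreover have "?P \<noteq> ?Q"
  proof
    assume "?P = ?Q"
    then have "f p \<in> ?Q" by blast
    then show False using d by (simp add: d_def inner_diff_right)
  qed
  moreover have "affine_parallel ?P ?Q"
  proof -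
    have "y \<in> (+) (f q - f p) ` ?P" if "y \<in> ?Q" for y
      using that by (intro image_eqI[of _ _ "y - (f q - f p)"]) (auto simp: inner_diff_right)
    then have "?Q = (+) (f q - f p) ` ?P" by (auto simp: inner_add_right inner_diff_right)
    then show ?thesis unfolding affine_parallel_def by blast
  qed
  ultimately have "norm_setdist N ?P ?Q = c" using constant_width unfolding constant_minkowski_width_def by blast
  moreover have "norm_setdist N ?P ?Q = d / (?\<xi> \<bullet> x)"
    unfolding norm_setdist_def
  proof (rule cInf_eq_minimum)
    \<comment> \<open>From \<open>f q\<close>, moving along \<open>x\<close> reaches the other plane most economically.\<close>
    let ?y = "f q + (d / (?\<xi> \<bullet> x)) *\<^sub>R x"
    have "?y \<in> ?P" using h by (simp add: d_def inner_add_right inner_diff_right)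
    moreover have "N (?y - f q) = d / (?\<xi> \<bullet> x)" using x d h by (simp add: norm_scale unit_sphere_def)
    ultimately show "d / (?\<xi> \<bullet> x) \<in> {N (y - z) |y z. y \<in> ?P \<and> z \<in> ?Q}"
      by (intro CollectI exI[of _ ?y] exI[of _ "f q"]) simp
    fix w assume "w \<in> {N (y - z) |y z. y \<in> ?P \<and> z \<in> ?Q}"
    then obtain y z where w: "w = N (y - z)" and "?\<xi> \<bullet> (y - z) = d" by (auto simp: d_def inner_diff_right)
    then show "d / (?\<xi> \<bullet> x) \<le> w" using dual_norm_bound[OF x, of "y - z"] h by (simp add: field_simps)
  qed
  ultimately show "?\<xi> \<bullet> (f p - f q) = c * (?\<xi> \<bullet> x)" using h by (simp add: d_def field_simps)
qed

definition antipodal :: "'a \<Rightarrow> 'a \<Rightarrow> bool" where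
  "antipodal p q \<longleftrightarrow> p \<in> topspace X \<and> q \<in> topspace X \<and> n q = - n p"

lemma antipodal_sym: "antipodal p q \<Longrightarrow> antipodal q p"
  by (simp add: antipodal_def)

text \<open>The functional \<open>- n p\<close> attains its maximum, at a point where it is the unit normal.\<close>

lemma antipodal_exists:
  assumes p: "p \<in> topspace X"
  shows "\<exists>q. antipodal p q"
proof -
  obtain q where q: "q \<in> topspace X" "\<And>r. r \<in> topspace X \<Longrightarrow> - n p \<bullet> f r \<le> - n p \<bullet> f q"
    using maximum_attained by blast
  have "- n p = n q" by (rule surf.normal_unique[OF q(1) _ q(2)]) (use unit_normal[OF p] in auto)
  then show ?thesis using p q(1) by (auto simp: antipodal_def)
qed

lemma eta_antipodal:
  assumes "antipodal p q"
  shows "\<eta> q = - \<eta> p"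
  using assms eta_in_sphere gauss_map_injective[of "\<eta> q" "- \<eta> p"] gauss_map_minus minus_in_sphere
  by (simp add: antipodal_def)

text \<open>In every direction \<open>\<nu> y\<close> the extent of the chord \<open>f p - f q\<close> is at most that of the surface, so its norm
  is at most \<open>c\<close>; in the direction \<open>n p\<close> the two are equal. Strict convexity of the ball leaves only
  \<open>c \<eta>(p)\<close>.\<close>

lemma antipodal_difference:
  assumes a: "antipodal p q"
  shows "f p - f q = c *\<^sub>R \<eta> p"
proof -
  let ?z = "f p - f q" and ?x = "\<eta> p"
  have p: "p \<in> topspace X" and q: "q \<in> topspace X" and nq: "n q = - n p" using a by (auto simp: antipodal_def)
  have x: "?x \<in> S" by (rule eta_in_sphere[OF p])
  have h: "0 < n p \<bullet> ?x" by (rule normal_inner_pos[OF x])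
  have min: "n p \<bullet> f q \<le> n p \<bullet> f r" if "r \<in> topspace X" for r using normal_supporting[OF q that] nq by simp
  have w: "n p \<bullet> ?z = c * (n p \<bullet> ?x)"
    by (rule width_in_direction(1)[OF x p _ q]) (use normal_supporting[OF p] min in auto)
  have wpos: "0 < n p \<bullet> ?z"
    by (rule width_in_direction(2)[OF x p _ q]) (use normal_supporting[OF p] min in auto)
  have c: "0 < c" using w wpos h by (simp add: zero_less_mult_iff)
  have z: "?z \<noteq> 0" using wpos by auto
  define y where "y = (1 / N ?z) *\<^sub>R ?z"
  have y: "y \<in> S" unfolding y_def by (rule normalized_in_sphere[OF z])
  have hy: "0 < \<nu> y \<bullet> y" by (rule normal_inner_pos[OF y])
  obtain p' where p': "p' \<in> topspace X" "\<And>r. r \<in> topspace X \<Longrightarrow> \<nu> y \<bullet> f r \<le> \<nu> y \<bullet> f p'"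
    using maximum_attained by blast
  obtain q' where q': "q' \<in> topspace X" "\<And>r. r \<in> topspace X \<Longrightarrow> - \<nu> y \<bullet> f r \<le> - \<nu> y \<bullet> f q'"
    using maximum_attained by blast
  have "\<nu> y \<bullet> ?z \<le> \<nu> y \<bullet> (f p' - f q')"
    using p'(2)[OF p] q'(2)[OF q] by (simp add: inner_diff_right)
  also have "\<dots> = c * (\<nu> y \<bullet> y)" by (rule width_in_direction(1)[OF y p'(1) _ q'(1)]) (use p'(2) q'(2) in auto)
  finally have "N ?z * (\<nu> y \<bullet> y) \<le> c * (\<nu> y \<bullet> y)" using norm_pos[OF z] by (simp add: y_def)
  then have "N ?z \<le> c" using hy by simp
  then have "N ((1 / c) *\<^sub>R ?z) \<le> 1" using c by (simp add: norm_scale)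
  moreover have "n p \<bullet> ((1 / c) *\<^sub>R ?z) = n p \<bullet> ?x" using w c by simp
  ultimately have "(1 / c) *\<^sub>R ?z = ?x" by (rule support_point_unique[OF x])
  then have "c *\<^sub>R ?x = (c * (1 / c)) *\<^sub>R ?z" by (metis scaleR_scaleR)
  then show ?thesis using c by simp
qed

text \<open>Equal unit normals at two different points would contradict strict convexity.\<close>

lemma antipodal_of_parallel_tangent_planes:
  assumes p: "p \<in> topspace X" and q: "q \<in> topspace X" and "p \<noteq> q"
    and T: "tangent_plane X f p = tangent_plane X f q"
  shows "antipodal p q"
proof -
  have "n q \<bullet> V = 0" if "n p \<bullet> V = 0" for V
    using that T surf.tangent_plane_eq[OF p] surf.tangent_plane_eq[OF q] by auto
  then obtain a where a: "n q = a *\<^sub>R n p"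
    using orthogonal_to_hyperplane_imp_multiple[OF unit_normal[OF p]] by blast
  then have "\<bar>a\<bar> = 1" using unit_normal[OF p] unit_normal[OF q] by simp
  moreover have "a \<noteq> 1"
    using a normal_strictly_supporting[OF p q] normal_strictly_supporting[OF q p] \<open>p \<noteq> q\<close> by auto
  ultimately have "a = -1" by linarith
  then show ?thesis using a p q by (simp add: antipodal_def)
qed

section \<open>Principal curvatures at antipodal points\<close>

abbreviation d\<eta> :: "'a \<Rightarrow> real^3 \<Rightarrow> real^3" where
  "d\<eta> \<equiv> surface_derivative X f \<eta>"

lemma d\<eta>: "p \<in> topspace X \<Longrightarrow> has_surface_derivative X f \<eta> p (d\<eta> p)"
  using birkhoff by (intro surface_derivative[OF immersed_surface]) (simp_all add: birkhoff_gauss_map_def)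

text \<open>Let \<open>\<alpha>\<close> map each point to its antipodal point. Along a curve \<open>\<gamma>\<close> through \<open>p\<close> with velocity \<open>V\<close>,
  \<open>f \<circ> \<alpha> \<circ> \<gamma> = f \<circ> \<gamma> - c \<eta> \<circ> \<gamma>\<close> shows that \<open>\<alpha> \<circ> \<gamma>\<close> converges to \<open>q\<close> in \<open>X\<close> (\<open>X\<close> is compact and \<open>f\<close> is
  injective) and has a velocity there, without any smoothness of \<open>\<alpha>\<close>. Then differentiate
  \<open>\<eta> \<circ> \<alpha> \<circ> \<gamma> = - \<eta> \<circ> \<gamma>\<close>.\<close>

lemma antipodal_derivative:
  assumes a: "antipodal p q" and V: "V \<in> tangent_plane X f p"
  shows "d\<eta> q (V - c *\<^sub>R d\<eta> p V) = - d\<eta> p V"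
proof -
  let ?B = "d\<eta> p" and ?B' = "d\<eta> q"
  have p: "p \<in> topspace X" and q: "q \<in> topspace X" using a by (auto simp: antipodal_def)
  obtain \<alpha> where \<alpha>: "\<And>x. x \<in> topspace X \<Longrightarrow> antipodal x (\<alpha> x)" using antipodal_exists by metis
  have f\<alpha>: "f (\<alpha> x) = f x - c *\<^sub>R \<eta> x" if "x \<in> topspace X" for x
    using antipodal_difference[OF \<alpha>[OF that]] by (simp add: algebra_simps)
  have \<alpha>X: "\<alpha> x \<in> topspace X" if "x \<in> topspace X" for x using \<alpha>[OF that] by (simp add: antipodal_def)
  have fq: "f q = f p - c *\<^sub>R \<eta> p" using antipodal_difference[OF a] by (simp add: algebra_simps)
  have \<alpha>p: "\<alpha> p = q" using f\<alpha>[OF p] fq \<alpha>X[OF p] q injective by (simp add: inj_on_def)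
  obtain \<gamma> where \<gamma>: "surface_curve X f p V \<gamma>" using surface_curve_exists[OF V] .
  then have \<gamma>0: "\<gamma> 0 = p" and fd: "((\<lambda>t. f (\<gamma> t)) has_vector_derivative V) (at 0)"
    by (auto simp: surface_curve_def)
  note ev = eventually_surface_curve[OF \<gamma>]
  have \<eta>d: "((\<lambda>t. \<eta> (\<gamma> t)) has_vector_derivative ?B V) (at 0)" by (rule has_surface_derivativeD[OF d\<eta>[OF p] \<gamma>])
  have "((\<lambda>t. f (\<gamma> t) - c *\<^sub>R \<eta> (\<gamma> t)) has_vector_derivative V - c *\<^sub>R ?B V) (at 0)"
    using fd \<eta>d by (auto intro!: derivative_eq_intros)
  moreover have "\<forall>\<^sub>F t in at 0. f (\<gamma> t) - c *\<^sub>R \<eta> (\<gamma> t) = f (\<alpha> (\<gamma> t))" using ev by eventually_elim (simp add: f\<alpha>)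
  ultimately have d: "((\<lambda>t. f (\<alpha> (\<gamma> t))) has_vector_derivative V - c *\<^sub>R ?B V) (at 0)"
    by (rule has_vector_derivative_transform_eventually) (simp add: \<gamma>0 \<alpha>p fq)
  have "\<forall>\<^sub>F t in at 0. \<alpha> (\<gamma> t) \<in> topspace X" using ev by eventually_elim (rule \<alpha>X)
  then have "limitin X (\<lambda>t. \<alpha> (\<gamma> t)) q (at 0)"
    using has_vector_derivative_imp_tendsto[OF d]
    by (intro limitin_of_injective_compact[OF compact continuous_map_f injective q]) (simp_all add: \<gamma>0 \<alpha>p)
  then have \<sigma>: "surface_curve X f q (V - c *\<^sub>R ?B V) (\<lambda>t. \<alpha> (\<gamma> t))" using d by (simp add: surface_curve_def \<gamma>0 \<alpha>p)
  have "((\<lambda>t. \<eta> (\<alpha> (\<gamma> t))) has_vector_derivative ?B' (V - c *\<^sub>R ?B V)) (at 0)"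
    by (rule has_surface_derivativeD[OF d\<eta>[OF q] \<sigma>])
  moreover have "((\<lambda>t. \<eta> (\<alpha> (\<gamma> t))) has_vector_derivative - ?B V) (at 0)"
  proof (rule has_vector_derivative_transform_eventually)
    show "((\<lambda>t. - \<eta> (\<gamma> t)) has_vector_derivative - ?B V) (at 0)" using \<eta>d by (rule has_vector_derivative_minus)
    show "\<forall>\<^sub>F t in at 0. - \<eta> (\<gamma> t) = \<eta> (\<alpha> (\<gamma> t))" using ev by eventually_elim (simp add: eta_antipodal[OF \<alpha>])
    show "- \<eta> (\<gamma> 0) = \<eta> (\<alpha> (\<gamma> 0))" using eta_antipodal[OF \<alpha>[OF p]] by (simp add: \<gamma>0)
  qed
  ultimately show ?thesis by (rule vector_derivative_unique_at)
qed

context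
  fixes p
  assumes p: "p \<in> topspace X"
begin

abbreviation (input) T :: "(real^3) set" where "T \<equiv> tangent_plane X f p"
abbreviation (input) A :: "real^3 \<Rightarrow> real^3" where "A \<equiv> d\<nu> (\<eta> p)"
abbreviation (input) B :: "real^3 \<Rightarrow> real^3" where "B \<equiv> d\<eta> p"

lemma eta_in_topspace_sphere: "\<eta> p \<in> topspace (sphere_top N)"
  using eta_in_sphere[OF p] by simp

lemma tangent_plane_sphere_eta: "tangent_plane (sphere_top N) id (\<eta> p) = T"
  using ball.tangent_plane_eq[OF eta_in_topspace_sphere] surf.tangent_plane_eq[OF p] by simp

lemma linear_derivatives: "linear A" "linear B"
  using d\<nu>[OF eta_in_sphere[OF p]] d\<eta>[OF p] by (auto simp: has_surface_derivative_def)

text \<open>The differential of the Euclidean Gauss map \<open>n = \<nu> \<circ> \<eta>\<close> of the surface, by the chain rule.\<close>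

lemma normal_derivative: "has_surface_derivative X f n p (\<lambda>V. A (B V))"
  by (rule has_surface_derivative_compose[OF d\<eta>[OF p] d\<nu>[OF eta_in_sphere[OF p]] eta_in_sphere])

lemma d\<eta>_tangent:
  assumes V: "V \<in> T"
  shows "B V \<in> T"
proof -
  obtain \<gamma> where \<gamma>: "surface_curve X f p V \<gamma>" using surface_curve_exists[OF V] .
  have "surface_curve (sphere_top N) id (\<eta> p) (B V) (\<lambda>t. \<eta> (\<gamma> t))"
    by (rule surface_curve_image[OF d\<eta>[OF p] eta_in_sphere \<gamma>])
  then show ?thesis using surface_curve_tangent[OF immersed_sphere] tangent_plane_sphere_eta by blast
qed

lemma normal_curvature_eq:
  assumes V: "V \<in> T"
  shows "normal_curvature N \<nu> X f \<eta> p V = (A V \<bullet> B V) / (A V \<bullet> V)"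
proof -
  have "surface_diff (sphere_top N) id \<nu> (\<eta> p) V = A V"
    using gauss V tangent_plane_sphere_eta
    by (intro surface_diff_eq_surface_derivative[OF immersed_sphere eta_in_topspace_sphere])
      (simp_all add: euclidean_gauss_map_def)
  moreover have "surface_diff X f \<eta> p V = B V"
    using birkhoff V by (intro surface_diff_eq_surface_derivative[OF immersed_surface p])
      (simp_all add: birkhoff_gauss_map_def)
  ultimately show ?thesis by (simp add: normal_curvature_def)
qed

lemma d\<eta>_injective:
  assumes V: "V \<in> T" "B V = 0"
  shows "V = 0"
proof (rule plane_det_positive_imp_injective[where L = B, OF _ _ linear_derivatives(2) d\<eta>_tangent _ _ V])
  show "subspace T" "dim T = 2" using tangent_plane_subspace[OF immersed_surface p] .
  show "0 < plane_det T (surface_diff X f \<eta> p)"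
    using curvature_pos[OF p] by (simp add: minkowski_gauss_curvature_def)
  show "surface_diff X f \<eta> p W = B W" if "W \<in> T" for W
    using birkhoff by (intro surface_diff_eq_surface_derivative[OF immersed_surface p _ that])
      (simp add: birkhoff_gauss_map_def)
qed

lemma d\<nu>_injective: "V \<in> T \<Longrightarrow> A V = 0 \<Longrightarrow> V = 0"
  using gauss_map_derivative_injective[OF eta_in_sphere[OF p]] tangent_plane_sphere_eta by blast

lemma d\<nu>_self_adjoint: "V \<in> T \<Longrightarrow> W \<in> T \<Longrightarrow> A V \<bullet> W = A W \<bullet> V"
  using ball.derivative_self_adjoint[OF eta_in_topspace_sphere d\<nu>[OF eta_in_sphere[OF p]]]
  by (simp add: tangent_plane_sphere_eta)

lemma normal_derivative_self_adjoint: "V \<in> T \<Longrightarrow> W \<in> T \<Longrightarrow> A (B V) \<bullet> W = A (B W) \<bullet> V"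
  by (rule surf.derivative_self_adjoint[OF p normal_derivative])

lemma d\<nu>_positive: "V \<in> T \<Longrightarrow> V \<noteq> 0 \<Longrightarrow> 0 < A V \<bullet> V"
  using ball.derivative_positive[OF eta_in_topspace_sphere d\<nu>[OF eta_in_sphere[OF p]]] d\<nu>_injective
  by (simp add: tangent_plane_sphere_eta)

lemma normal_derivative_positive:
  assumes V: "V \<in> T" "V \<noteq> 0"
  shows "0 < A (B V) \<bullet> V"
proof (rule surf.derivative_positive[OF p normal_derivative V])
  fix W assume W: "W \<in> T" "A (B W) = 0"
  have "B W = 0" by (rule d\<nu>_injective[OF d\<eta>_tangent[OF W(1)] W(2)])
  then show "W = 0" by (rule d\<eta>_injective[OF W(1)])
qed

lemma unit_circle_nonzero: "V \<in> unit_circle N X f p \<Longrightarrow> V \<in> T \<and> V \<noteq> 0"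
  using norm_eq_zero[of 0] by (auto simp: unit_circle_def)

lemma normal_curvature_pos:
  assumes "V \<in> unit_circle N X f p"
  shows "0 < normal_curvature N \<nu> X f \<eta> p V"
proof -
  have V: "V \<in> T" "V \<noteq> 0" using unit_circle_nonzero[OF assms] by auto
  have "A V \<bullet> B V = A (B V) \<bullet> V" by (rule d\<nu>_self_adjoint[OF V(1) d\<eta>_tangent[OF V(1)]])
  then show ?thesis
    using d\<nu>_positive[OF V] normal_derivative_positive[OF V] by (simp add: normal_curvature_eq[OF V(1)])
qed

lemma normal_curvature_eigenvector:
  assumes "V \<in> unit_circle N X f p" and eig: "B V = a *\<^sub>R V"
  shows "normal_curvature N \<nu> X f \<eta> p V = a"
proof -
  have V: "V \<in> T" "V \<noteq> 0" using unit_circle_nonzero[OF assms(1)] by auto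
  then show ?thesis using d\<nu>_positive[OF V] by (simp add: normal_curvature_eq[OF V(1)] eig)
qed

lemma normal_curvature_extremum:
  assumes "s \<noteq> 0"
  shows "\<exists>V\<in>unit_circle N X f p.
    (\<forall>Z\<in>unit_circle N X f p. s * normal_curvature N \<nu> X f \<eta> p Z \<le> s * normal_curvature N \<nu> X f \<eta> p V) \<and>
    B V = normal_curvature N \<nu> X f \<eta> p V *\<^sub>R V"
proof -
  have T: "subspace T" "dim T = 2" using tangent_plane_subspace[OF immersed_surface p] .
  have nz: "T \<noteq> {0}"
  proof
    assume "T = {0}"
    then have "dim T = dim {0 :: real^3}" by (rule arg_cong)
    then show False unfolding T(2) dim_singleton by simp
  qed
  have "\<exists>V\<in>{V \<in> T. N V = 1}.
      (\<forall>Z\<in>{V \<in> T. N V = 1}. s * ((A Z \<bullet> B Z) / (A Z \<bullet> Z)) \<le> s * ((A V \<bullet> B V) / (A V \<bullet> V))) \<and>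
      B V = ((A V \<bullet> B V) / (A V \<bullet> V)) *\<^sub>R V"
    by (rule rayleigh_quotient_extremum[OF T(1) nz linear_derivatives d\<eta>_tangent d\<nu>_self_adjoint
          normal_derivative_self_adjoint d\<nu>_positive assms])
  moreover have "unit_circle N X f p = {V \<in> T. N V = 1}" by (simp add: unit_circle_def)
  ultimately show ?thesis using normal_curvature_eq by simp
qed

end

text \<open>On an eigenvector, \<open>antipodal_derivative\<close> reads \<open>(1 - c k) d\<eta>\<^sub>q V = - k V\<close>, and \<open>k > 0\<close> excludes
  \<open>c k = 1\<close>.\<close>

lemma antipodal_eigenvector:
  assumes a: "antipodal p q" and T: "tangent_plane X f p = tangent_plane X f q"
    and V: "V \<in> unit_circle N X f p" and eig: "d\<eta> p V = k *\<^sub>R V"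
  shows "normal_curvature N \<nu> X f \<eta> q V * (c * k - 1) = k"
proof -
  have p: "p \<in> topspace X" and q: "q \<in> topspace X" using a by (auto simp: antipodal_def)
  have V': "V \<in> tangent_plane X f p" "V \<noteq> 0" using unit_circle_nonzero[OF p V] by auto
  have Vq: "V \<in> unit_circle N X f q" using V T by (simp add: unit_circle_def)
  have linq: "linear (d\<eta> q)" by (rule linear_derivatives(2)[OF q])
  have "k = normal_curvature N \<nu> X f \<eta> p V" by (rule normal_curvature_eigenvector[OF p V eig, symmetric])
  then have k: "0 < k" using normal_curvature_pos[OF p V] by simp
  have "d\<eta> q (V - c *\<^sub>R d\<eta> p V) = - d\<eta> p V" by (rule antipodal_derivative[OF a V'(1)])
  moreover have "V - c *\<^sub>R d\<eta> p V = (1 - c * k) *\<^sub>R V" by (simp add: eig algebra_simps)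
  ultimately have "(1 - c * k) *\<^sub>R d\<eta> q V = - (k *\<^sub>R V)" by (simp add: eig linear_cmul[OF linq])
  then have eq: "(c * k - 1) *\<^sub>R d\<eta> q V = k *\<^sub>R V" by (simp add: algebra_simps)
  then have nz: "c * k - 1 \<noteq> 0" using k V'(2) by auto
  have "d\<eta> q V = (1 / (c * k - 1)) *\<^sub>R ((c * k - 1) *\<^sub>R d\<eta> q V)" using nz by simp
  also have "\<dots> = (k / (c * k - 1)) *\<^sub>R V" by (simp add: eq)
  finally have "normal_curvature N \<nu> X f \<eta> q V = k / (c * k - 1)"
    by (rule normal_curvature_eigenvector[OF q Vq])
  then show ?thesis using nz by simp
qed

end

theorem theorem4p1:
  fixes N :: "real^3 \<Rightarrow> real" and \<nu> :: "real^3 \<Rightarrow> real^3"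
    and X :: "'a topology" and f :: "'a \<Rightarrow> real^3" and \<eta> :: "'a \<Rightarrow> real^3"
    and p q :: 'a and c :: real
  assumes "admissible_norm N"
    and "euclidean_gauss_map (sphere_top N) id \<nu>"
    and "immersed_surface X f"
    and "compact_space X"
    and "strictly_convex_surface X f"
    and "birkhoff_gauss_map N X f \<eta>"
    and "constant_minkowski_width N X f c"
    and "\<And>x. x \<in> topspace X \<Longrightarrow> 0 < minkowski_gauss_curvature X f \<eta> x"
    and "p \<in> topspace X" and "q \<in> topspace X" and "p \<noteq> q"
    and "tangent_plane X f p = tangent_plane X f q"
  shows "\<exists>V\<in>unit_circle N X f p. \<exists>W\<in>unit_circle N X f q.
      (\<forall>Z\<in>unit_circle N X f p. normal_curvature N \<nu> X f \<eta> p Z \<le> normal_curvature N \<nu> X f \<eta> p V) \<and>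
      (\<forall>Z\<in>unit_circle N X f q. normal_curvature N \<nu> X f \<eta> q W \<le> normal_curvature N \<nu> X f \<eta> q Z) \<and>
      1 / normal_curvature N \<nu> X f \<eta> p V + 1 / normal_curvature N \<nu> X f \<eta> q W = c"
proof -
  interpret constant_width_surface N \<nu> X f \<eta> c
    using assms by unfold_locales auto
  have a: "antipodal p q" using assms(9-12) by (rule antipodal_of_parallel_tangent_planes)
  let ?kp = "normal_curvature N \<nu> X f \<eta> p" and ?kq = "normal_curvature N \<nu> X f \<eta> q"
  have circle: "unit_circle N X f q = unit_circle N X f p" using assms(12) by (simp add: unit_circle_def)
  obtain V where V: "V \<in> unit_circle N X f p" and Vmax: "\<And>Z. Z \<in> unit_circle N X f p \<Longrightarrow> ?kp Z \<le> ?kp V"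
    and BV: "d\<eta> p V = ?kp V *\<^sub>R V"
    using normal_curvature_extremum[OF assms(9), of 1] by auto
  obtain W where W: "W \<in> unit_circle N X f q" and Wmin: "\<And>Z. Z \<in> unit_circle N X f q \<Longrightarrow> ?kq W \<le> ?kq Z"
    and BW: "d\<eta> q W = ?kq W *\<^sub>R W"
    using normal_curvature_extremum[OF assms(10), of "-1"] by auto
  have pos: "0 < ?kp V" "0 < ?kq W" "0 < ?kq V" "0 < ?kp W"
    using normal_curvature_pos assms(9,10) V W circle by auto
  \<comment> \<open>The principal direction \<open>V\<close> at \<open>p\<close> is one at \<open>q\<close>, and \<open>W\<close> is one at \<open>p\<close>. The minimality of \<open>?kq W\<close>
    and the maximality of \<open>?kp V\<close> then give the two inequalities \<open>c \<le> 1 / ?kp V + 1 / ?kq W\<close> and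
    \<open>c \<ge> 1 / ?kp V + 1 / ?kq W\<close>, cleared of denominators.\<close>
  have 1: "?kq V * (c * ?kp V - 1) = ?kp V" by (rule antipodal_eigenvector[OF a assms(12) V BV])
  have 2: "?kp W * (c * ?kq W - 1) = ?kq W"
    by (rule antipodal_eigenvector[OF antipodal_sym[OF a] assms(12)[symmetric] W BW])
  have "0 < c * ?kp V - 1" by (rule zero_less_mult_pos[of "?kq V"]) (simp_all only: 1 pos)
  then have "?kq W * (c * ?kp V - 1) \<le> ?kq V * (c * ?kp V - 1)"
    using Wmin V circle by (intro mult_right_mono) auto
  moreover have "0 < c * ?kq W - 1" by (rule zero_less_mult_pos[of "?kp W"]) (simp_all only: 2 pos)
  then have "?kp W * (c * ?kq W - 1) \<le> ?kp V * (c * ?kq W - 1)"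
    using Vmax W circle by (intro mult_right_mono) auto
  ultimately have "?kp V + ?kq W = c * (?kp V * ?kq W)" unfolding 1 2 by (simp add: right_diff_distrib mult.commute mult.left_commute)
  then have "(?kp V + ?kq W) / (?kp V * ?kq W) = c" using pos by simp
  moreover have "1 / ?kp V + 1 / ?kq W = (?kp V + ?kq W) / (?kp V * ?kq W)" using pos by (simp add: add_frac_eq add.commute)
  ultimately have "1 / ?kp V + 1 / ?kq W = c" by (simp only:)
  then show ?thesis using V W Vmax Wmin by blast
qed

end
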